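(* Let $k>1$ be an integer and let $n\geq k^4+3k^3+5k^2+5k+4$. Let $G$ be a balanced bipartite graph with $2n$ vertices and minimum degree $\delta(G)\geq k$. If \[ q(G)\geq 2n-k, \] then $G$ has a Hamiltonian cycle, unless $G\in\mathcal{B}_1(n,k)$.
   Context: All graphs are simple and finite. A bipartite graph is balanced if its two vertex parts have the same size. For a graph $G$, $Q(G)=D+A$ is the signless Laplacian matrix ($D$ the diagonal degree matrix, $A$ the adjacency matrix), and $q(G)$ denotes the largest eigenvalue of $Q(G)$. For $E'\subseteq E(G)$, $G-E'$ is $G$ with the edges of $E'$ deleted. Membership in the family below is understood up to isomorphism. For $k>1$ and $n\geq 2k$, let $B_k(n)$ be the graph obtained from $K_{n,n}$ by deleting all edges of a subgraph $K_{k,n-k}$. Concretely, let the parts be $S$ and $T$ with $|S|=|T|=n$, choose $X\subseteq S$ with $|X|=k$ and $W\subseteq T$ with $|W|=n-k$, and delete all edges between $X$ and $W$. Set $Y=T\setminus W$ and $Z=S\setminus X$; thus vertices of $X$ have degree $k$, vertices of $Y$ and $Z$ have degree $n$, and vertices of $W$ have degree $n-k$. Let $E_1(B_k(n))$ be the set of edges of $B_k(n)$ with both endpoints in $Y\cup W\cup Z$. Define \[ \mathcal{B}_1(n,k)=\{B_k(n)-E' : E'\subseteq E_1(B_k(n)),\ |E'|\leq\lfloor k^2/4\rfloor\}. \] *)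

theory Defs
  imports Complex_Main "Jordan_Normal_Form.Char_Poly"
begin

record 'a ugraph =
  verts :: "'a set"
  edges :: "'a set set"

definition simple_graph :: "'a ugraph \<Rightarrow> bool" where
  "simple_graph G \<longleftrightarrow>
     finite (verts G) \<and> (\<forall>e\<in>edges G. e \<subseteq> verts G \<and> card e = 2)"

definition vdegree :: "'a ugraph \<Rightarrow> 'a \<Rightarrow> nat" where
  "vdegree G v = card {e \<in> edges G. v \<in> e}"

text \<open>Only meaningful for a finite nonempty vertex set.\<close>

definition min_degree :: "'a ugraph \<Rightarrow> nat" where
  "min_degree G = Min (vdegree G ` verts G)"

definition bipartition :: "'a ugraph \<Rightarrow> 'a set \<Rightarrow> 'a set \<Rightarrow> bool" where
  "bipartition G S T \<longleftrightarrow>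
     S \<union> T = verts G \<and> S \<inter> T = {} \<and> (\<forall>e\<in>edges G. \<exists>s\<in>S. \<exists>t\<in>T. e = {s, t})"

definition balanced_bipartite :: "'a ugraph \<Rightarrow> bool" where
  "balanced_bipartite G \<longleftrightarrow> (\<exists>S T. bipartition G S T \<and> card S = card T)"

text \<open>A Hamiltonian cycle is given by the list of its vertices in cyclic order.\<close>

definition hamiltonian_cycle :: "'a ugraph \<Rightarrow> 'a list \<Rightarrow> bool" where
  "hamiltonian_cycle G vs \<longleftrightarrow>
     distinct vs \<and> set vs = verts G \<and> 3 \<le> length vs \<and>
     (\<forall>i<length vs. {vs ! i, vs ! (Suc i mod length vs)} \<in> edges G)"

definition hamiltonian :: "'a ugraph \<Rightarrow> bool" where
  "hamiltonian G \<longleftrightarrow> (\<exists>vs. hamiltonian_cycle G vs)"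

definition isomorphic :: "'a ugraph \<Rightarrow> 'b ugraph \<Rightarrow> bool" where
  "isomorphic G H \<longleftrightarrow>
     (\<exists>f. bij_betw f (verts G) (verts H) \<and>
          (\<forall>u\<in>verts G. \<forall>v\<in>verts G. {u, v} \<in> edges G \<longleftrightarrow> {f u, f v} \<in> edges H))"

definition delete_edges :: "'a ugraph \<Rightarrow> 'a set set \<Rightarrow> 'a ugraph" where
  "delete_edges G E' = G\<lparr>edges := edges G - E'\<rparr>"

text \<open>The matrices are taken with respect to a list \<open>vs\<close> that enumerates the vertices without
  repetition.\<close>

definition degree_matrix :: "'a ugraph \<Rightarrow> 'a list \<Rightarrow> real mat" where
  "degree_matrix G vs = mat (length vs) (length vs)
     (\<lambda>(i, j). if i = j then real (vdegree G (vs ! i)) else 0)"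

definition adjacency_matrix :: "'a ugraph \<Rightarrow> 'a list \<Rightarrow> real mat" where
  "adjacency_matrix G vs = mat (length vs) (length vs)
     (\<lambda>(i, j). if {vs ! i, vs ! j} \<in> edges G then 1 else 0)"

definition signless_laplacian :: "'a ugraph \<Rightarrow> 'a list \<Rightarrow> real mat" where
  "signless_laplacian G vs = degree_matrix G vs + adjacency_matrix G vs"

definition vertex_list :: "'a ugraph \<Rightarrow> 'a list" where
  "vertex_list G = (SOME vs. distinct vs \<and> set vs = verts G)"

text \<open>The matrix is symmetric, so all its complex eigenvalues are real. Its spectrum does not depend
  on the enumeration, by \<open>eigenvalue_signless_laplacian_enum\<close> below.\<close>

definition q_index :: "'a ugraph \<Rightarrow> real" where
  "q_index G = Max {c. eigenvalue (signless_laplacian G (vertex_list G)) c}"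

lemma vertex_list:
  assumes "finite (verts G)"
  shows "distinct (vertex_list G)" "set (vertex_list G) = verts G"
proof -
  have "\<exists>vs. distinct vs \<and> set vs = verts G"
    using finite_distinct_list[OF assms] by blast
  from someI_ex[OF this] show "distinct (vertex_list G)" "set (vertex_list G) = verts G"
    by (auto simp: vertex_list_def)
qed

lemma eigenvalue_signless_laplacian_iff:
  assumes "distinct vs"
  shows "eigenvalue (signless_laplacian G vs) c \<longleftrightarrow>
    (\<exists>f. (\<exists>v\<in>set vs. f v \<noteq> 0) \<and>
      (\<forall>v\<in>set vs. real (vdegree G v) * f v +
         (\<Sum>u\<in>set vs. if {v, u} \<in> edges G then f u else 0) = c * f v))"
    (is "_ \<longleftrightarrow> (\<exists>f. ?P f)")
proof -
  let ?n = "length vs" and ?Q = "signless_laplacian G vs"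
  have sum_vs: "sum h (set vs) = (\<Sum>j<?n. h (vs ! j))" for h :: "'a \<Rightarrow> real"
    by (rule sum.reindex_bij_betw[symmetric]) (rule bij_betw_nth[OF assms refl refl])
  have dim: "dim_row ?Q = ?n" "dim_col ?Q = ?n"
    by (simp_all add: signless_laplacian_def degree_matrix_def adjacency_matrix_def)
  have Qx: "(?Q *\<^sub>v x) $ i = real (vdegree G (vs ! i)) * x $ i
      + (\<Sum>j<?n. if {vs ! i, vs ! j} \<in> edges G then x $ j else 0)"
    if x: "x \<in> carrier_vec ?n" and i: "i < ?n" for x i
  proof -
    have "(?Q *\<^sub>v x) $ i = (\<Sum>j<?n. ?Q $$ (i, j) * x $ j)"
      using x i dim by (simp add: scalar_prod_def atLeast0LessThan)
    also have "\<dots> = (\<Sum>j<?n. (if j = i then real (vdegree G (vs ! i)) * x $ i else 0)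
        + (if {vs ! i, vs ! j} \<in> edges G then x $ j else 0))"
      using i by (intro sum.cong refl)
        (auto simp: signless_laplacian_def degree_matrix_def adjacency_matrix_def algebra_simps)
    finally show ?thesis using i by (simp add: sum.distrib)
  qed
  have ev: "eigenvector ?Q x c \<longleftrightarrow> ?P f"
    if x: "x \<in> carrier_vec ?n" and f: "\<And>i. i < ?n \<Longrightarrow> x $ i = f (vs ! i)" for x f
  proof -
    have "x \<noteq> 0\<^sub>v ?n \<longleftrightarrow> (\<exists>v\<in>set vs. f v \<noteq> 0)"
      using x f by (auto simp: vec_eq_iff in_set_conv_nth Bex_def)
    moreover have "?Q *\<^sub>v x = c \<cdot>\<^sub>v x \<longleftrightarrow>
      (\<forall>v\<in>set vs. real (vdegree G v) * f v +
         (\<Sum>u\<in>set vs. if {v, u} \<in> edges G then f u else 0) = c * f v)"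
    proof -
      have "?Q *\<^sub>v x = c \<cdot>\<^sub>v x \<longleftrightarrow> (\<forall>i<?n. (?Q *\<^sub>v x) $ i = c * x $ i)"
        using x dim by (auto simp: vec_eq_iff)
      also have "\<dots> \<longleftrightarrow> (\<forall>i<?n. real (vdegree G (vs ! i)) * f (vs ! i) +
         (\<Sum>j<?n. if {vs ! i, vs ! j} \<in> edges G then f (vs ! j) else 0) = c * f (vs ! i))"
      proof -
        have "(\<Sum>j<?n. if {vs ! i, vs ! j} \<in> edges G then x $ j else 0)
          = (\<Sum>j<?n. if {vs ! i, vs ! j} \<in> edges G then f (vs ! j) else 0)" for i
          by (intro sum.cong refl) (auto simp: f)
        then show ?thesis by (simp add: Qx[OF x] f)
      qed
      finally show ?thesis by (simp add: sum_vs all_set_conv_all_nth)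
    qed
    ultimately show ?thesis using x dim by (auto simp: eigenvector_def)
  qed
  show ?thesis
  proof
    assume "eigenvalue ?Q c"
    then obtain x where e: "eigenvector ?Q x c" by (auto simp: eigenvalue_def)
    then have x: "x \<in> carrier_vec ?n" using dim by (auto simp: eigenvector_def)
    define f where "f v = x $ (THE i. i < ?n \<and> vs ! i = v)" for v
    have "x $ i = f (vs ! i)" if "i < ?n" for i
    proof -
      have "(THE j. j < ?n \<and> vs ! j = vs ! i) = i"
        using that assms by (intro the_equality) (auto simp: nth_eq_iff_index_eq)
      then show ?thesis by (simp add: f_def)
    qed
    from ev[of x f, OF x this] e show "\<exists>f. ?P f" by blast
  next
    assume "\<exists>f. ?P f"
    then obtain f where "?P f" by blast
    then have "eigenvector ?Q (vec ?n (\<lambda>i. f (vs ! i))) c"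
      using ev[of "vec ?n (\<lambda>i. f (vs ! i))" f] by simp
    then show "eigenvalue ?Q c" by (auto simp: eigenvalue_def)
  qed
qed

lemma eigenvalue_signless_laplacian_enum:
  assumes "distinct vs" "distinct ws" "set vs = set ws"
  shows "eigenvalue (signless_laplacian G vs) c \<longleftrightarrow> eigenvalue (signless_laplacian G ws) c"
  using assms by (simp add: eigenvalue_signless_laplacian_iff)

text \<open>The concrete copy of \<open>B_k(n)\<close> lives on \<open>nat + nat\<close>: the part \<open>S\<close> is the left copy of
  \<open>{..<n}\<close> and the part \<open>T\<close> the right copy. The definitions are intended for \<open>n \<ge> 2 * k\<close>.\<close>

definition complete_bipartite :: "'a set \<Rightarrow> 'a set \<Rightarrow> 'a ugraph" where
  "complete_bipartite S T = \<lparr>verts = S \<union> T, edges = {{s, t} | s t. s \<in> S \<and> t \<in> T}\<rparr>"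

definition part_S :: "nat \<Rightarrow> (nat + nat) set" where
  "part_S n = Inl ` {..<n}"

definition part_T :: "nat \<Rightarrow> (nat + nat) set" where
  "part_T n = Inr ` {..<n}"

definition part_X :: "nat \<Rightarrow> (nat + nat) set" where
  "part_X k = Inl ` {..<k}"

definition part_W :: "nat \<Rightarrow> nat \<Rightarrow> (nat + nat) set" where
  "part_W k n = Inr ` {..<n - k}"

definition part_Y :: "nat \<Rightarrow> nat \<Rightarrow> (nat + nat) set" where
  "part_Y k n = part_T n - part_W k n"

definition part_Z :: "nat \<Rightarrow> nat \<Rightarrow> (nat + nat) set" where
  "part_Z k n = part_S n - part_X k"

definition B_graph :: "nat \<Rightarrow> nat \<Rightarrow> (nat + nat) ugraph" where
  "B_graph k n = delete_edges (complete_bipartite (part_S n) (part_T n))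
                   (edges (complete_bipartite (part_X k) (part_W k n)))"

definition E1 :: "nat \<Rightarrow> nat \<Rightarrow> (nat + nat) set set" where
  "E1 k n = {e \<in> edges (B_graph k n). e \<subseteq> part_Y k n \<union> part_W k n \<union> part_Z k n}"

definition B1_family :: "nat \<Rightarrow> nat \<Rightarrow> (nat + nat) ugraph set" where
  "B1_family n k =
     {delete_edges (B_graph k n) E' | E'. E' \<subseteq> E1 k n \<and> card E' \<le> k\<^sup>2 div 4}"

definition in_B1_family :: "'a ugraph \<Rightarrow> nat \<Rightarrow> nat \<Rightarrow> bool" where
  "in_B1_family G n k \<longleftrightarrow> (\<exists>H\<in>B1_family n k. isomorphic G H)"

end

theory Submission
  imports Defs
begin

text \<open>Let \<open>f\<close> be an eigenvector for \<open>c = q(G) \<ge> 2n - k\<close>. Merris' bound on the largest eigenvalue forces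
  \<open>e(G) \<ge> n(n - k)\<close>. If \<open>G\<close> is not Hamiltonian, extend it to an edge-maximal non-Hamiltonian bipartite
  graph; there \<open>d(s) + d(t) \<le> n\<close> for all nonadjacent \<open>s\<close>, \<open>t\<close> on opposite sides. Together with the few
  missing edges this leaves exactly \<open>k\<close> vertices of low degree, all on one side and all with the same \<open>k\<close>
  neighbours, so \<open>G\<close> is a spanning subgraph of \<open>B_k(n)\<close>.

  Finally \<open>c * \<parallel>f\<parallel>\<^sup>2\<close> is the sum of \<open>(f s + f t)\<^sup>2\<close> over the edges. The vertices of \<open>X\<close> can be eliminated
  from this identity by the inequality between arithmetic and geometric means, and what remains is a
  perturbation of the form of the complete bipartite graph on \<open>Z\<close> and \<open>T\<close>, whose largest eigenvalue is
  exactly \<open>2n - k\<close>. With more than \<open>k\<^sup>2 / 4\<close> missing edges the perturbation is negative, which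
  contradicts \<open>c \<ge> 2n - k\<close>.\<close>

subsection \<open>Hamiltonian cycles in bipartite graphs\<close>

text \<open>Ordered pairs make a bipartite graph a relation \<open>E\<close> from \<open>S\<close>
  to \<open>T\<close>: neighbourhoods are images, exchanging the sides is taking the converse, and
  the adjacency is \<open>E \<union> E\<inverse>\<close>.\<close>

definition ham_rel :: "'a set \<Rightarrow> ('a \<times> 'a) set \<Rightarrow> bool" where
  "ham_rel V R \<longleftrightarrow> (\<exists>vs. distinct vs \<and> set vs = V \<and> 3 \<le> length vs \<and>
     (\<forall>i<length vs. (vs ! i, vs ! (Suc i mod length vs)) \<in> R))"

definition ham_path :: "'a set \<Rightarrow> ('a \<times> 'a) set \<Rightarrow> 'a list \<Rightarrow> bool" where
  "ham_path V R vs \<longleftrightarrow> distinct vs \<and> set vs = V \<and> 3 \<le> length vs \<and>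
     (\<forall>i. Suc i < length vs \<longrightarrow> (vs ! i, vs ! Suc i) \<in> R)"

lemma ham_path_rev:
  assumes "ham_path V R vs" "sym R"
  shows "ham_path V R (rev vs)"
  unfolding ham_path_def
proof (intro conjI allI impI)
  fix i assume i: "Suc i < length (rev vs)"
  let ?j = "length vs - Suc (Suc i)"
  have "(vs ! ?j, vs ! Suc ?j) \<in> R" using assms(1) i unfolding ham_path_def by auto
  moreover have "Suc ?j = length vs - Suc i" using i by auto
  ultimately show "(rev vs ! i, rev vs ! Suc i) \<in> R" using i assms(2)
    by (auto simp: rev_nth dest: symD)
qed (use assms in \<open>auto simp: ham_path_def\<close>)

text \<open>Rotating the cycle so that the added edge closes it leaves a path in \<open>R\<close>,
  because a cycle of length at least 3 uses each edge only once. Reversal fixes the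
  orientation.\<close>

lemma ham_path_of_closing_edge:
  assumes "sym R" "ham_rel V (insert (s, t) (insert (t, s) R))" "\<not> ham_rel V R"
  obtains vs where "ham_path V R vs" "hd vs = s" "last vs = t"
proof -
  let ?R' = "insert (s, t) (insert (t, s) R)"
  obtain vs where vs: "distinct vs" "set vs = V" "3 \<le> length vs"
    "\<forall>i<length vs. (vs ! i, vs ! (Suc i mod length vs)) \<in> ?R'"
    using assms(2) unfolding ham_rel_def by blast
  obtain i where i: "i < length vs" "(vs ! i, vs ! (Suc i mod length vs)) \<notin> R"
    using assms(3) vs unfolding ham_rel_def by blast
  define L where "L = length vs"
  define ws where "ws = rotate (Suc i) vs"
  have lw: "length ws = L" by (simp add: ws_def L_def)
  have L3: "3 \<le> L" using vs by (simp add: L_def)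
  have nth: "ws ! j = vs ! ((Suc i + j) mod L)" if "j < L" for j
    using that unfolding ws_def L_def by (simp add: nth_rotate del: rotate_Suc)
  have step: "(ws ! j, ws ! Suc j) \<in> ?R'" if "Suc j < L" for j
  proof -
    have "(Suc i + j) mod L < L" using L3 by (intro mod_less_divisor) simp
    then have "(Suc i + j) mod L < length vs" by (simp add: L_def)
    then have "(vs ! ((Suc i + j) mod L), vs ! (Suc ((Suc i + j) mod L) mod length vs)) \<in> ?R'"
      using vs(4) by blast
    then show ?thesis using that nth[of j] nth[of "Suc j"] by (simp add: L_def mod_Suc_eq)
  qed
  have dw: "distinct ws" using vs by (simp add: ws_def)
  have w0: "ws ! 0 = vs ! (Suc i mod L)" using nth[of 0] L3 by simp
  have "Suc i + (L - 1) = i + L" using L3 by simp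
  then have "(Suc i + (L - 1)) mod L = i" using i by (simp add: L_def)
  then have wl: "ws ! (L - 1) = vs ! i" using nth[of "L - 1"] L3 by simp
  have close: "(ws ! (L - 1), ws ! 0) \<in> {(s, t), (t, s)}"
    using vs(4) i w0 wl by (auto simp: L_def)
  \<comment> \<open>A second use of the closing edge would force \<open>Suc j = L\<close> or
    \<open>L = 2\<close>.\<close>
  have stepR: "(ws ! j, ws ! Suc j) \<in> R" if "Suc j < L" for j
  proof (rule ccontr)
    assume "(ws ! j, ws ! Suc j) \<notin> R"
    then have "{ws ! j, ws ! Suc j} = {ws ! (L - 1), ws ! 0}" using step[OF that] close by auto
    then have "(ws ! j = ws ! (L - 1) \<and> ws ! Suc j = ws ! 0) \<or> (ws ! j = ws ! 0 \<and> ws ! Suc j = ws ! (L - 1))"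
      by (auto simp: doubleton_eq_iff)
    then show False using dw that L3 lw by (auto simp: nth_eq_iff_index_eq)
  qed
  have hp: "ham_path V R ws" using dw vs stepR lw L3 by (auto simp: ham_path_def ws_def)
  have ne: "ws \<noteq> []" using lw L3 by auto
  have hl: "hd ws = ws ! 0" "last ws = ws ! (L - 1)" using ne lw by (simp_all add: hd_conv_nth last_conv_nth)
  show ?thesis
  proof (cases "hd ws = s \<and> last ws = t")
    case True then show ?thesis using that hp by blast
  next
    case False
    then have "hd ws = t \<and> last ws = s" using close hl by auto
    then show ?thesis using that[of "rev ws"] ham_path_rev[OF hp assms(1)] ne
      by (simp add: hd_rev last_rev)
  qed
qed

text \<open>The cycle follows the path to \<open>vs ! i\<close>, jumps to the end, runs backwards to
  \<open>vs ! Suc i\<close> and closes at the head.\<close>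

lemma ham_rel_crossing:
  assumes "ham_path V R vs" "sym R" "Suc i < length vs"
    "(vs ! i, last vs) \<in> R" "(hd vs, vs ! Suc i) \<in> R"
  shows "ham_rel V R"
proof -
  define L where "L = length vs"
  define ws where "ws = take (Suc i) vs @ rev (drop (Suc i) vs)"
  have P: "distinct vs" "set vs = V" "3 \<le> L" "\<And>i. Suc i < L \<Longrightarrow> (vs ! i, vs ! Suc i) \<in> R"
    using assms(1) by (auto simp: ham_path_def L_def)
  have iL: "Suc i < L" using assms by (simp add: L_def)
  have lw: "length ws = L" using iL by (simp add: ws_def L_def)
  have dw: "distinct ws" "set ws = V"
  proof -
    have "distinct (take (Suc i) vs @ drop (Suc i) vs)" using P by simp
    then show "distinct ws" unfolding ws_def distinct_append by simp
    have "set ws = set (take (Suc i) vs @ drop (Suc i) vs)" unfolding ws_def set_append by simp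
    then show "set ws = V" using P by simp
  qed
  have n1: "ws ! j = vs ! j" if "j \<le> i" for j using that iL by (simp add: ws_def nth_append L_def)
  have n2: "ws ! j = vs ! (L + i - j)" if "i < j" "j < L" for j
  proof -
    have "Suc (i + length vs - Suc j) = length vs + i - j" using that by (simp add: L_def)
    then show ?thesis using that iL by (simp add: ws_def nth_append L_def rev_nth)
  qed
  have hl: "hd vs = vs ! 0" "last vs = vs ! (L - 1)"
    using P(3) hd_conv_nth[of vs] last_conv_nth[of vs] by (cases vs; simp add: L_def)+
  have "(ws ! j, ws ! (Suc j mod L)) \<in> R" if j: "j < L" for j
  proof -
    consider "j < i" | "j = i" | "i < j" "Suc j < L" | "j = L - 1" "i < j" using j iL by linarith
    then show ?thesis
    proof cases
      case 1 then show ?thesis using n1 P(4)[of j] iL by simp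
    next
      case 2 then show ?thesis using n1[of i] n2[of "Suc i"] iL assms(4) hl by simp
    next
      case 3
      have "Suc (L + i - Suc j) = L + i - j" "L + i - j < L" using 3 by auto
      then have "(vs ! (L + i - j), vs ! (L + i - Suc j)) \<in> R"
        using P(4)[of "L + i - Suc j"] symD[OF assms(2)] by metis
      then show ?thesis using 3 n2[of j] n2[of "Suc j"] by simp
    next
      case 4
      then have "L + i - j = Suc i" using iL by auto
      then show ?thesis using 4 n2[of j] n1[of 0] j P(3) symD[OF assms(2) assms(5)] hl by simp
    qed
  qed
  then show ?thesis using dw lw P(3) unfolding ham_rel_def by auto
qed

text \<open>The predecessor on the path of a neighbour of \<open>hd vs\<close> lies in
  \<open>S\<close> and is not adjacent to \<open>last vs\<close>, since otherwise the two edges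
  cross and close a cycle. Distinct neighbours have distinct predecessors, so both degrees fit into
  \<open>card S\<close>.\<close>

lemma degree_sum_of_ham_path:
  assumes fin: "finite S" "finite T" and E: "E \<subseteq> S \<times> T" and disj: "S \<inter> T = {}"
    and path: "ham_path (S \<union> T) (E \<union> E\<inverse>) vs" and st: "hd vs \<in> S" "last vs \<in> T"
    and non: "\<not> ham_rel (S \<union> T) (E \<union> E\<inverse>)"
  shows "card {t. (hd vs, t) \<in> E} + card {s. (s, last vs) \<in> E} \<le> card S"
proof -
  let ?R = "E \<union> E\<inverse>"
  let ?A = "{t. (hd vs, t) \<in> E}" and ?B = "{s. (s, last vs) \<in> E}"
  have symR: "sym ?R" by (auto simp: sym_def)
  have P: "distinct vs" "set vs = S \<union> T" "3 \<le> length vs"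
    "\<And>i. Suc i < length vs \<Longrightarrow> (vs ! i, vs ! Suc i) \<in> ?R"
    using path by (auto simp: ham_path_def)
  have finB: "finite ?B" using E fin by (auto intro: finite_subset[of _ S])
  define I where "I = {i. Suc i < length vs \<and> vs ! Suc i \<in> ?A}"
  have finI: "finite I" by (rule finite_subset[of _ "{..<length vs}"]) (auto simp: I_def)
  have "?A \<subseteq> (\<lambda>i. vs ! Suc i) ` I"
  proof
    fix t assume t: "t \<in> ?A"
    then have tT: "t \<in> T" using E by auto
    then obtain j where j: "j < length vs" "vs ! j = t" using P(2) by (metis UnCI in_set_conv_nth)
    have "vs \<noteq> []" using P(3) by auto
    then have "j \<noteq> 0" using st(1) tT disj j by (auto simp: hd_conv_nth)
    then obtain i where "j = Suc i" using not0_implies_Suc by auto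
    then show "t \<in> (\<lambda>i. vs ! Suc i) ` I" using j t by (auto simp: I_def)
  qed
  then have 1: "card ?A \<le> card I" using finI by (rule surj_card_le[rotated])
  have "inj_on (\<lambda>i. vs ! i) I" using P(1) by (auto simp: inj_on_def I_def nth_eq_iff_index_eq)
  moreover have "(\<lambda>i. vs ! i) ` I \<subseteq> S - ?B"
  proof
    fix x assume "x \<in> (\<lambda>i. vs ! i) ` I"
    then obtain i where i: "i \<in> I" "x = vs ! i" by auto
    have "vs ! Suc i \<in> T" using i E by (auto simp: I_def)
    moreover have "(vs ! i, vs ! Suc i) \<in> ?R" using i P(4) by (auto simp: I_def)
    ultimately have "x \<in> S" using i(2) E disj by auto
    moreover have "x \<notin> ?B"
      using ham_rel_crossing[OF path symR, of i] i non by (auto simp: I_def)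
    ultimately show "x \<in> S - ?B" by blast
  qed
  ultimately have 2: "card I \<le> card (S - ?B)" using fin by (metis card_image card_mono finite_Diff)
  have "?B \<subseteq> S" using E by auto
  then have "card (S - ?B) = card S - card ?B" "card ?B \<le> card S"
    using fin finB by (auto simp: card_Diff_subset card_mono)
  then show ?thesis using 1 2 by linarith
qed

lemma ham_rel_complete:
  assumes "finite S" "finite T" "card S = n" "card T = n" "2 \<le> n" "S \<inter> T = {}"
  shows "ham_rel (S \<union> T) (S \<times> T \<union> (S \<times> T)\<inverse>)"
proof -
  obtain f where f: "bij_betw f {..<n} S"
    using assms ex_bij_betw_nat_finite[of S] by (auto simp: atLeast0LessThan)
  obtain g where g: "bij_betw g {..<n} T"
    using assms ex_bij_betw_nat_finite[of T] by (auto simp: atLeast0LessThan)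
  define h where "h i = (if even i then f (i div 2) else g (i div 2))" for i :: nat
  have fS: "f i \<in> S" and gT: "g i \<in> T" if "i < n" for i
    using that f g by (auto simp: bij_betw_def)
  have hS: "h i \<in> S" if "even i" "i < 2 * n" for i using that fS by (auto simp: h_def)
  have hT: "h i \<in> T" if "odd i" "i < 2 * n" for i using that gT by (auto simp: h_def)
  have inj: "inj_on h {..<2 * n}"
  proof (rule inj_onI)
    fix i j assume ij: "i \<in> {..<2 * n}" "j \<in> {..<2 * n}" "h i = h j"
    have par: "even i = even j" using hS hT ij assms(6) by (metis IntI empty_iff lessThan_iff)
    have "i div 2 = j div 2"
    proof (cases "even i")
      case True
      then show ?thesis using ij par bij_betw_imp_inj_on[OF f] by (auto simp: h_def inj_on_def)
    next
      case False
      then have "g (i div 2) = g (j div 2)" using ij par by (auto simp: h_def)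
      moreover have "i div 2 < n" "j div 2 < n" using ij by auto
      ultimately show ?thesis using bij_betw_imp_inj_on[OF g] by (auto simp: inj_on_def)
    qed
    then show "i = j" using par by (metis dvd_mult_div_cancel odd_two_times_div_two_succ)
  qed
  have img: "h ` {..<2 * n} = S \<union> T"
  proof
    show "h ` {..<2 * n} \<subseteq> S \<union> T" using hS hT by blast
    show "S \<union> T \<subseteq> h ` {..<2 * n}"
    proof
      fix x assume "x \<in> S \<union> T"
      then consider i where "i < n" "x = f i" | i where "i < n" "x = g i"
        using f g by (auto simp: bij_betw_def)
      then show "x \<in> h ` {..<2 * n}"
      proof cases
        case (1 i) then have "x = h (2 * i)" "2 * i < 2 * n" by (auto simp: h_def)
        then show ?thesis by blast
      next
        case (2 i) then have "x = h (2 * i + 1)" "2 * i + 1 < 2 * n" by (auto simp: h_def)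
        then show ?thesis by blast
      qed
    qed
  qed
  let ?vs = "map h [0..<2 * n]"
  have "(?vs ! i, ?vs ! (Suc i mod length ?vs)) \<in> S \<times> T \<union> (S \<times> T)\<inverse>" if i: "i < length ?vs" for i
  proof -
    have m: "Suc i mod (2 * n) < 2 * n" using assms by simp
    \<comment> \<open>Reduction modulo the even number \<open>2 * n\<close> preserves parity, so the
      closing edge changes sides as well.\<close>
    have e: "even (Suc i mod (2 * n)) = even (Suc i)" by (simp add: dvd_mod_iff)
    have "?vs ! i = h i" "?vs ! (Suc i mod length ?vs) = h (Suc i mod (2 * n))" using i m by simp_all
    then show ?thesis using hS[of i] hT[of i] hS[OF _ m] hT[OF _ m] e i by auto
  qed
  moreover have "distinct ?vs" using inj by (simp add: distinct_map lessThan_atLeast0)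
  moreover have "set ?vs = S \<union> T" using img by (simp add: lessThan_atLeast0)
  moreover have "3 \<le> length ?vs" using assms by simp
  ultimately show ?thesis unfolding ham_rel_def by blast
qed

subsection \<open>Dense non-Hamiltonian bipartite graphs\<close>

text \<open>\<open>M\<close> holds the missing edges, so a vertex of low degree has a large image.
  Doubling the cardinality avoids rounding for odd \<open>n\<close>.\<close>

definition low :: "nat \<Rightarrow> ('a \<times> 'b) set \<Rightarrow> 'a set" where
  "low n M = {s. n \<le> 2 * card (M `` {s})}"

lemma sum_card_Image:
  assumes "finite M" "finite A"
  shows "(\<Sum>s\<in>A. card (M `` {s})) = card {p\<in>M. fst p \<in> A}"
proof -
  have "{p\<in>M. fst p \<in> A} = (SIGMA s:A. M `` {s})" by force
  moreover have "\<forall>s\<in>A. finite (M `` {s})" using assms(1) by (auto intro: finite_Image)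
  ultimately show ?thesis using assms by (simp add: card_SigmaI)
qed

text \<open>\<open>M\<close> is the bipartite complement of an edge-maximal non-Hamiltonian graph; \<open>low n M\<close> are the
  vertices of degree at most \<open>n / 2\<close> on one side. A vertex outside \<open>low\<close> misses only low vertices of the
  other side, which makes its degree so large that low vertices have degree at most \<open>card (low n M)\<close>.\<close>

lemma low_side:
  fixes M :: "('a \<times> 'b) set"
  assumes fin: "finite S" "finite T" and M: "M \<subseteq> S \<times> T"
    and n: "4 * k\<^sup>2 + 4 * k < n" and card_M: "card M \<le> n * k"
    and mS: "\<And>s. s \<in> S \<Longrightarrow> card (M `` {s}) + k \<le> n"
    and ore: "\<And>s t. (s, t) \<in> M \<Longrightarrow> n \<le> card (M `` {s}) + card (M\<inverse> `` {t})"
  shows "finite (low n M)" "low n M \<subseteq> S" "card (low n M) \<le> 2 * k"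
    and "card (low n (M\<inverse>)) \<le> 2 * k \<Longrightarrow> finite (low n (M\<inverse>)) \<Longrightarrow> low n M \<noteq> {} \<Longrightarrow>
      card (low n M) = k \<and> (\<forall>s\<in>low n M. card (M `` {s}) + k = n)"
proof -
  let ?A = "low n M" and ?B = "low n (M\<inverse>)"
  have finM: "finite M" using M fin by (meson finite_SigmaI finite_subset)
  show AS: "?A \<subseteq> S"
  proof
    fix s assume "s \<in> ?A"
    then have "card (M `` {s}) \<noteq> 0" using n by (auto simp: low_def)
    then have "M `` {s} \<noteq> {}" by auto
    then show "s \<in> S" using M by auto
  qed
  show finA: "finite ?A" using AS fin finite_subset by blast
  have sumA: "(\<Sum>s\<in>?A. card (M `` {s})) \<le> n * k"
    unfolding sum_card_Image[OF finM finA]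
    using card_mono[OF finM, of "{p\<in>M. fst p \<in> ?A}"] card_M by auto
  \<comment> \<open>Double counting: each low vertex accounts for at least n / 2 of the at most
    \<open>n * k\<close> missing edges.\<close>
  have "card ?A * n \<le> (\<Sum>s\<in>?A. 2 * card (M `` {s}))"
    using sum_mono[of ?A "\<lambda>_. n" "\<lambda>s. 2 * card (M `` {s})"] by (auto simp: low_def)
  also have "\<dots> \<le> 2 * (n * k)" using sumA by (simp flip: sum_distrib_left)
  finally have "n * card ?A \<le> n * (2 * k)" by (simp add: mult.commute mult.left_commute)
  then show A2: "card ?A \<le> 2 * k" using n by simp
  assume B2: "card ?B \<le> 2 * k" and finB: "finite ?B" and ne: "?A \<noteq> {}"
  \<comment> \<open>A low \<open>s\<close> misses more than \<open>2 * k\<close> vertices, hence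
    some \<open>t\<close> outside \<open>?B\<close>. By \<open>ore\<close>, everything that
    \<open>t\<close> misses lies in \<open>?A\<close>, and \<open>ore\<close> at
    \<open>(s, t)\<close> then gives the bound.\<close>
  have mA: "n \<le> card (M `` {s}) + card ?A" if s: "s \<in> ?A" for s
  proof -
    have "n \<le> 2 * card (M `` {s})" using s by (simp add: low_def)
    then have "card ?B < card (M `` {s})" using B2 n by linarith
    then have "\<not> M `` {s} \<subseteq> ?B" using card_mono[OF finB] by (meson not_le)
    then obtain t where t: "(s, t) \<in> M" "t \<notin> ?B" by auto
    have "M\<inverse> `` {t} \<subseteq> ?A"
    proof
      fix s' assume "s' \<in> M\<inverse> `` {t}"
      then have "n \<le> card (M `` {s'}) + card (M\<inverse> `` {t})" using ore by auto
      then show "s' \<in> ?A" using t(2) by (auto simp: low_def)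
    qed
    then have "card (M\<inverse> `` {t}) \<le> card ?A" using finA card_mono by blast
    then show ?thesis using ore[OF t(1)] by linarith
  qed
  let ?a = "card ?A"
  \<comment> \<open>The count is repeated with the sharper \<open>mA\<close>. The error
    \<open>?a * ?a\<close> is at most \<open>4 * k\<^sup>2\<close>, which is less than
    \<open>n\<close>, so \<open>?a\<close> cannot reach \<open>k + 1\<close>.\<close>
  have "?a * n \<le> (\<Sum>s\<in>?A. card (M `` {s}) + ?a)"
    using sum_mono[of ?A "\<lambda>_. n" "\<lambda>s. card (M `` {s}) + ?a"] mA by auto
  also have "\<dots> \<le> n * k + ?a * ?a" using sumA by (simp add: sum.distrib)
  also have "?a * ?a \<le> (2 * k) * (2 * k)" using A2 by (intro mult_mono) auto
  finally have "?a * n \<le> n * k + 4 * k\<^sup>2" by (simp add: power2_eq_square)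
  then have "?a * n < n * (k + 1)" using n by simp
  then have "n * ?a < n * (k + 1)" by (simp add: mult.commute)
  then have "?a < k + 1" by (simp only: mult_less_cancel1)
  then have ak: "?a \<le> k" by simp
  have ge: "card (M `` {s}) + k \<le> n" if "s \<in> ?A" for s using that AS mS by auto
  obtain s where "s \<in> ?A" using ne by auto
  \<comment> \<open>The minimum degree gives the inequality opposite to \<open>mA\<close>; both are
    compatible only if \<open>?a = k\<close>.\<close>
  then have "?a = k" using mA ge ak by (meson add_le_cancel_left le_antisym le_trans)
  then show "?a = k \<and> (\<forall>s\<in>?A. card (M `` {s}) + k = n)"
    using mA ge by (auto intro: le_antisym)
qed

text \<open>A vertex \<open>t\<close> missed by one low vertex has at least \<open>k\<close> missing
  edges by \<open>ore\<close>. As no vertex on its side is low, all of these lead to low vertices,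
  and there are only \<open>k\<close> of them. So all low vertices miss the same set, whose
  complement in \<open>T\<close> is \<open>Y\<close>.\<close>

lemma low_block:
  fixes M :: "('a \<times> 'b) set"
  assumes fin: "finite S" "finite T" and M: "M \<subseteq> S \<times> T" and cT: "card T = n"
    and A: "card (low n M) = k" "finite (low n M)" "\<And>s. s \<in> low n M \<Longrightarrow> card (M `` {s}) + k = n"
    and B: "low n (M\<inverse>) = {}" and k: "k \<ge> 1"
    and ore: "\<And>s t. (s, t) \<in> M \<Longrightarrow> n \<le> card (M `` {s}) + card (M\<inverse> `` {t})"
  shows "\<exists>Y\<subseteq>T. card Y = k \<and> low n M \<times> (T - Y) \<subseteq> M"
proof -
  let ?A = "low n M"
  obtain x0 where x0: "x0 \<in> ?A" using A(1) k by (metis all_not_in_conv card.empty not_one_le_zero)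
  have MT: "M `` {x0} \<subseteq> T" using M by auto
  have "(x, t) \<in> M" if x: "x \<in> ?A" and t: "(x0, t) \<in> M" for x t
  proof (rule ccontr)
    assume xt: "(x, t) \<notin> M"
    have "M\<inverse> `` {t} \<subseteq> ?A - {x}"
    proof
      fix s assume s: "s \<in> M\<inverse> `` {t}"
      then have "n \<le> card (M `` {s}) + card (M\<inverse> `` {t})" using ore by auto
      moreover have "t \<notin> low n (M\<inverse>)" using B by simp
      ultimately show "s \<in> ?A - {x}" using s xt by (auto simp: low_def)
    qed
    then have "card (M\<inverse> `` {t}) \<le> card (?A - {x})" using A(2) by (intro card_mono) auto
    then have "card (M\<inverse> `` {t}) < k" using x A(1,2) k by (simp add: card_Diff_singleton)
    then show False using ore[OF t] A(3)[OF x0] by linarith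
  qed
  then have "?A \<times> (T - (T - M `` {x0})) \<subseteq> M" by auto
  moreover have "card (T - M `` {x0}) = k"
    using A(3)[OF x0] cT MT fin by (auto simp: card_Diff_subset finite_subset)
  ultimately show ?thesis by blast
qed

lemma Image_compl:
  assumes "E \<subseteq> S \<times> T" "s \<in> S" "finite T"
  shows "card ((S \<times> T - E) `` {s}) + card (E `` {s}) = card T"
proof -
  have "(S \<times> T - E) `` {s} = T - E `` {s}" "E `` {s} \<subseteq> T" using assms by auto
  then show ?thesis using assms by (simp add: card_Diff_subset finite_subset card_mono)
qed

text \<open>A block missing from a maximal non-Hamiltonian \<open>F \<supseteq> E\<close> is missing
  from \<open>E\<close> as well, so the structure is read off from \<open>F\<close>. The two
  alternatives say which side carries the low vertices.\<close>

lemma ham_rel_or_block: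
  fixes E :: "('a \<times> 'a) set"
  assumes fin: "finite S" "finite T" and disj: "S \<inter> T = {}" and E: "E \<subseteq> S \<times> T"
    and card: "card S = n" "card T = n" and k: "k \<ge> 1" and n: "4 * k\<^sup>2 + 4 * k < n"
    and dS: "\<And>s. s \<in> S \<Longrightarrow> k \<le> card (E `` {s})"
    and dT: "\<And>t. t \<in> T \<Longrightarrow> k \<le> card (E\<inverse> `` {t})"
    and card_E: "n * n \<le> card E + n * k"
    and non: "\<not> ham_rel (S \<union> T) (E \<union> E\<inverse>)"
  shows "(\<exists>X\<subseteq>S. \<exists>Y\<subseteq>T. card X = k \<and> card Y = k \<and> E \<inter> X \<times> (T - Y) = {}) \<or>
    (\<exists>X\<subseteq>T. \<exists>Y\<subseteq>S. card X = k \<and> card Y = k \<and> E\<inverse> \<inter> X \<times> (S - Y) = {})"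
proof -
  let ?P = "{F. E \<subseteq> F \<and> F \<subseteq> S \<times> T \<and> \<not> ham_rel (S \<union> T) (F \<union> F\<inverse>)}"
  have "finite ?P" by (rule finite_subset[of _ "Pow (S \<times> T)"]) (use fin in auto)
  moreover have "E \<in> ?P" using E non by auto
  ultimately obtain F where F: "F \<in> ?P" "\<And>G. G \<in> ?P \<Longrightarrow> F \<subseteq> G \<Longrightarrow> F = G"
    using finite_has_maximal2[of ?P E] by (auto 0 4)
  define M where "M = S \<times> T - F"
  have FST: "F \<subseteq> S \<times> T" "E \<subseteq> F" "F\<inverse> \<subseteq> T \<times> S" and nonF: "\<not> ham_rel (S \<union> T) (F \<union> F\<inverse>)" using F(1) by auto
  have finF: "finite F" using FST fin by (meson finite_SigmaI finite_subset)
  have MI: "M\<inverse> = T \<times> S - F\<inverse>" by (auto simp: M_def)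
  have M: "M \<subseteq> S \<times> T" "M\<inverse> \<subseteq> T \<times> S" by (auto simp: M_def)
  have finM: "finite M" using M fin by (meson finite_SigmaI finite_subset)
  have mS: "card (M `` {s}) + card (F `` {s}) = n" if "s \<in> S" for s
    using Image_compl[OF FST(1) that fin(2)] card by (simp add: M_def)
  have mT: "card (M\<inverse> `` {t}) + card (F\<inverse> `` {t}) = n" if "t \<in> T" for t
    using Image_compl[OF FST(3) that fin(1)] card MI by simp
  have dS': "k \<le> card (F `` {s})" if "s \<in> S" for s
    using dS[OF that] card_mono[of "F `` {s}" "E `` {s}"] FST(2) finF
    by (meson Image_mono finite_Image le_trans order_refl)
  have dT': "k \<le> card (F\<inverse> `` {t})" if "t \<in> T" for t
    using dT[OF that] card_mono[of "F\<inverse> `` {t}" "E\<inverse> `` {t}"] FST(2) finF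
    by (meson Image_mono converse_mono finite_Image finite_converse le_trans order_refl)
  \<comment> \<open>By maximality, adding a missing edge creates a Hamiltonian cycle, hence
    \<open>F\<close> has a Hamiltonian path between its ends, and the degrees of these ends in
    \<open>F\<close> sum to at most \<open>n\<close>.\<close>
  have ore: "n \<le> card (M `` {s}) + card (M\<inverse> `` {t})" if st: "(s, t) \<in> M" for s t
  proof -
    have sS: "s \<in> S" "t \<in> T" "(s, t) \<notin> F" using st by (auto simp: M_def)
    let ?G = "insert (s, t) F"
    have "?G \<notin> ?P" using F(2)[of ?G] sS by blast
    then have "ham_rel (S \<union> T) (?G \<union> ?G\<inverse>)" using FST sS by auto
    moreover have "?G \<union> ?G\<inverse> = insert (s, t) (insert (t, s) (F \<union> F\<inverse>))" by auto
    ultimately have "ham_rel (S \<union> T) (insert (s, t) (insert (t, s) (F \<union> F\<inverse>)))" by simp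
    then obtain vs where vs: "ham_path (S \<union> T) (F \<union> F\<inverse>) vs" "hd vs = s" "last vs = t"
      by (rule ham_path_of_closing_edge[rotated]) (use nonF in \<open>auto simp: sym_def\<close>)
    have "card {t. (hd vs, t) \<in> F} + card {s. (s, last vs) \<in> F} \<le> card S"
      using vs sS by (intro degree_sum_of_ham_path[OF fin FST(1) disj vs(1)] nonF) auto
    moreover have "{t. (hd vs, t) \<in> F} = F `` {s}" "{s. (s, last vs) \<in> F} = F\<inverse> `` {t}" using vs by auto
    ultimately show ?thesis using mS[OF sS(1)] mT[OF sS(2)] card by simp
  qed
  have ore': "n \<le> card (M\<inverse> `` {s}) + card ((M\<inverse>)\<inverse> `` {t})" if "(s, t) \<in> M\<inverse>" for s t
    using that ore[of t s] by (simp add: add.commute)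
  have "card M = n * n - card F" using FST finF fin card by (simp add: M_def card_Diff_subset card_cartesian_product)
  moreover have "card E \<le> card F" using FST finF by (simp add: card_mono)
  ultimately have card_M: "card M \<le> n * k" using card_E by linarith
  then have card_M': "card (M\<inverse>) \<le> n * k" by (simp add: card_inverse)
  have bS: "card (M `` {s}) + k \<le> n" if "s \<in> S" for s using mS[OF that] dS'[OF that] by linarith
  have bT: "card (M\<inverse> `` {t}) + k \<le> n" if "t \<in> T" for t using mT[OF that] dT'[OF that] by linarith
  note sideS = low_side[OF fin M(1) n card_M bS ore]
  note sideT = low_side[OF fin(2,1) M(2) n card_M' bT ore']
  let ?A = "low n M" and ?B = "low n (M\<inverse>)"
  have A: "card ?A = k \<and> (\<forall>s\<in>?A. card (M `` {s}) + k = n)" if "?A \<noteq> {}"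
    using sideS(4) sideT(1,3) that by blast
  have B: "card ?B = k \<and> (\<forall>s\<in>?B. card (M\<inverse> `` {s}) + k = n)" if "?B \<noteq> {}"
    using sideT(4) sideS(1,3) that by simp
  consider "?A \<noteq> {}" "?B \<noteq> {}" | "?A = {}" "?B = {}" | "?A \<noteq> {}" "?B = {}" | "?A = {}" "?B \<noteq> {}" by blast
  then show ?thesis
  proof cases
    case 1
    \<comment> \<open>Low vertices on both sides would give \<open>k * (n - k)\<close> missing edges
      at each side, with at most \<open>k * k\<close> counted twice. This exceeds
      \<open>n * k\<close> because \<open>n > 3 * k\<close>.\<close>
    have "k * n = (\<Sum>s\<in>?A. card (M `` {s}) + k)" using A[OF 1(1)] by simp
    also have "\<dots> = (\<Sum>s\<in>?A. card (M `` {s})) + k * k" using A[OF 1(1)] by (subst sum.distrib) simp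
    finally have a: "k * n = card {p\<in>M. fst p \<in> ?A} + k * k"
      using sum_card_Image[OF finM sideS(1)] by simp
    have "k * n = (\<Sum>s\<in>?B. card (M\<inverse> `` {s}) + k)" using B[OF 1(2)] by simp
    also have "\<dots> = (\<Sum>s\<in>?B. card (M\<inverse> `` {s})) + k * k" using B[OF 1(2)] by (subst sum.distrib) simp
    finally have "k * n = card {p\<in>M\<inverse>. fst p \<in> ?B} + k * k"
      using sum_card_Image[OF _ sideT(1), of "M\<inverse>"] finM by simp
    moreover have "{p\<in>M\<inverse>. fst p \<in> ?B} = {p\<in>M. snd p \<in> ?B}\<inverse>" by auto
    ultimately have b: "k * n = card {p\<in>M. snd p \<in> ?B} + k * k" by (simp add: card_inverse)
    let ?U = "{p\<in>M. fst p \<in> ?A}" and ?V = "{p\<in>M. snd p \<in> ?B}"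
    have "card ?U + card ?V = card (?U \<union> ?V) + card (?U \<inter> ?V)"
      using finM by (intro card_Un_Int) auto
    moreover have "card (?U \<union> ?V) \<le> card M" using finM by (intro card_mono) auto
    moreover have "card (?U \<inter> ?V) \<le> card (?A \<times> ?B)" using sideS(1) sideT(1) by (intro card_mono) auto
    then have "card (?U \<inter> ?V) \<le> k * k" using A[OF 1(1)] B[OF 1(2)] by (simp add: card_cartesian_product)
    ultimately have "k * n \<le> 3 * (k * k)" using a b card_M by (simp add: mult.commute)
    moreover have "k * (3 * k) < k * n"
    proof -
      have "3 * k < n" using n by linarith
      then show ?thesis using k by (intro mult_strict_left_mono) auto
    qed
    ultimately show ?thesis by simp
  next
    case 2
    \<comment> \<open>Without low vertices \<open>ore\<close> forbids missing edges, and the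
      complete bipartite graph is Hamiltonian.\<close>
    have "M = {}"
    proof (rule ccontr)
      assume "M \<noteq> {}"
      then obtain s t where "(s, t) \<in> M" by auto
      then have "n \<le> 2 * card (M `` {s}) \<or> n \<le> 2 * card (M\<inverse> `` {t})" using ore by force
      then show False using 2 by (auto simp: low_def)
    qed
    then have "F = S \<times> T" using FST by (auto simp: M_def)
    moreover have "2 \<le> n" using n k by linarith
    ultimately show ?thesis using nonF ham_rel_complete[OF fin card _ disj] by simp
  next
    case 3
    obtain Y where Y: "Y \<subseteq> T" "card Y = k" "?A \<times> (T - Y) \<subseteq> M"
      using low_block[OF fin M(1) card(2) _ sideS(1) _ 3(2) k ore] A[OF 3(1)] by auto
    then have "E \<inter> ?A \<times> (T - Y) = {}" using FST by (auto simp: M_def)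
    then show ?thesis using Y A[OF 3(1)] sideS(2) by blast
  next
    case 4
    obtain Y where Y: "Y \<subseteq> S" "card Y = k" "?B \<times> (S - Y) \<subseteq> M\<inverse>"
      using low_block[OF fin(2,1) M(2) card(1) _ sideT(1) _ _ k ore'] B[OF 4(2)] 4(1) by auto
    then have "E\<inverse> \<inter> ?B \<times> (S - Y) = {}" using FST by (auto simp: M_def)
    then show ?thesis using Y B[OF 4(2)] sideT(2) by blast
  qed
qed

subsection \<open>Spectral bounds\<close>

text \<open>Merris' bound at a vertex \<open>v\<close> that maximizes \<open>\<bar>f v\<bar> / d v\<close>: the largest eigenvalue is at most
  \<open>d v\<close> plus the average degree of the neighbours of \<open>v\<close>.\<close>

lemma edge_bound_side:
  fixes f :: "'a \<Rightarrow> real"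
  assumes fin: "finite S" "finite T" and E: "E \<subseteq> S \<times> T" and card: "card T = n"
    and v: "v \<in> S" "f v \<noteq> 0" "E `` {v} \<noteq> {}"
    and eq: "(\<Sum>t\<in>E `` {v}. f v + f t) = c * f v"
    and c: "c \<ge> 2 * real n - real k" and k: "k \<le> n"
    and dS: "\<And>t. t \<in> T \<Longrightarrow> card (E\<inverse> `` {t}) \<le> n"
    and mx: "\<And>t. t \<in> T \<Longrightarrow> \<bar>f t\<bar> * card (E `` {v}) \<le> \<bar>f v\<bar> * card (E\<inverse> `` {t})"
  shows "n * n \<le> card E + n * k"
proof (rule ccontr)
  let ?d = "real (card (E `` {v}))"
  let ?e = "real (card E)" and ?n = "real n" and ?k = "real k"
  define q where "q = (\<Sum>t\<in>E `` {v}. real (card (E\<inverse> `` {t})))"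
  assume "\<not> ?thesis"
  then have "real (card E + n * k) < real (n * n)" by (simp only: of_nat_less_iff not_le)
  then have e: "?e < ?n * ?n - ?n * ?k" by simp
  have finE: "finite E" using E fin by (meson finite_SigmaI finite_subset)
  have NT: "E `` {v} \<subseteq> T" using E by auto
  have finN: "finite (E `` {v})" using finE by (rule finite_Image)
  have d0: "?d > 0" using v(3) finN by (simp add: card_gt_0_iff)
  have dn: "?d \<le> ?n" using card_mono[OF fin(2) NT] card by simp
  have c0: "c \<ge> 0" using c k by linarith
  \<comment> \<open>Multiplying the eigenvalue equation at \<open>v\<close> by the degree of
    \<open>v\<close> lets \<open>mx\<close> trade each \<open>f t\<close> for the degree of
    \<open>t\<close>; the result is \<open>cd\<close>.\<close>
  have "c * \<bar>f v\<bar> = \<bar>\<Sum>t\<in>E `` {v}. f v + f t\<bar>" using eq c0 by (simp add: abs_mult)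
  also have "\<dots> \<le> (\<Sum>t\<in>E `` {v}. \<bar>f v\<bar> + \<bar>f t\<bar>)"
    by (rule order_trans[OF sum_abs]) (rule sum_mono, rule abs_triangle_ineq)
  also have "\<dots> = ?d * \<bar>f v\<bar> + (\<Sum>t\<in>E `` {v}. \<bar>f t\<bar>)" by (simp add: sum.distrib)
  finally have "c * \<bar>f v\<bar> * ?d \<le> (?d * \<bar>f v\<bar> + (\<Sum>t\<in>E `` {v}. \<bar>f t\<bar>)) * ?d"
    using d0 by (intro mult_right_mono) auto
  also have "\<dots> = ?d * ?d * \<bar>f v\<bar> + (\<Sum>t\<in>E `` {v}. \<bar>f t\<bar> * ?d)"
    by (simp add: algebra_simps sum_distrib_left)
  also have "(\<Sum>t\<in>E `` {v}. \<bar>f t\<bar> * ?d) \<le> \<bar>f v\<bar> * q"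
    unfolding q_def sum_distrib_left using mx NT by (intro sum_mono) auto
  finally have "(c * ?d) * \<bar>f v\<bar> \<le> (?d * ?d + q) * \<bar>f v\<bar>" by (simp add: algebra_simps)
  then have cd: "c * ?d \<le> ?d * ?d + q" using v(2) by simp
  \<comment> \<open>\<open>q\<close> is bounded twice, by \<open>?d * ?n\<close> and by the number
    of edges. The first bound confines \<open>?d\<close> to the interval from \<open>?n - ?k\<close>
    to \<open>?n\<close>.\<close>
  have "q \<le> (\<Sum>t\<in>E `` {v}. ?n)" unfolding q_def using dS NT by (intro sum_mono) auto
  then have q1: "q \<le> ?d * ?n" by simp
  have "q \<le> (\<Sum>t\<in>T. real (card (E\<inverse> `` {t})))"
    unfolding q_def using NT fin by (intro sum_mono2) auto
  also have "\<dots> = real (card {p\<in>E\<inverse>. fst p \<in> T})"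
    using sum_card_Image[of "E\<inverse>" T] finE fin by (simp flip: of_nat_sum)
  also have "{p\<in>E\<inverse>. fst p \<in> T} = E\<inverse>" using E by auto
  also have "real (card (E\<inverse>)) = ?e" by (simp add: card_inverse)
  finally have q2: "q \<le> ?e" .
  have lam: "(2 * ?n - ?k) * ?d \<le> ?d * ?d + q"
    using mult_right_mono[OF c, of ?d] d0 cd by linarith
  have "(2 * ?n - ?k) * ?d \<le> (?d + ?n) * ?d" using lam q1 by (simp add: algebra_simps)
  then have "?d - (?n - ?k) \<ge> 0" using d0 by simp
  \<comment> \<open>On this interval the concave function \<open>?d * (2 * ?n - ?k - ?d)\<close> is
    at least \<open>?n * (?n - ?k)\<close>, its value at both ends.\<close>
  then have "(?n - ?d) * (?d - (?n - ?k)) \<ge> 0" using dn by (intro mult_nonneg_nonneg) auto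
  moreover have "(?n - ?d) * (?d - (?n - ?k)) = (2 * ?n - ?k) * ?d - ?d * ?d - (?n * ?n - ?n * ?k)"
    by (simp add: algebra_simps)
  ultimately show False using lam q2 e by linarith
qed

text \<open>The maximum of \<open>\<bar>f v\<bar> / d v\<close> is taken over both sides at once;
  the side where it is attained plays the role of \<open>S\<close> in
  \<open>edge_bound_side\<close>.\<close>

lemma edge_bound:
  fixes f :: "'a \<Rightarrow> real"
  assumes fin: "finite S" "finite T" and E: "E \<subseteq> S \<times> T" and card: "card S = n" "card T = n"
    and eqS: "\<And>s. s \<in> S \<Longrightarrow> (\<Sum>t\<in>E `` {s}. f s + f t) = c * f s"
    and eqT: "\<And>t. t \<in> T \<Longrightarrow> (\<Sum>s\<in>E\<inverse> `` {t}. f t + f s) = c * f t"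
    and c: "c \<ge> 2 * real n - real k" and k: "k \<le> n"
    and dS: "\<And>s. s \<in> S \<Longrightarrow> E `` {s} \<noteq> {}" and dT: "\<And>t. t \<in> T \<Longrightarrow> E\<inverse> `` {t} \<noteq> {}"
    and disj: "S \<inter> T = {}" and nz: "\<exists>v\<in>S \<union> T. f v \<noteq> 0"
  shows "n * n \<le> card E + n * k"
proof -
  define d where "d v = real (if v \<in> S then card (E `` {v}) else card (E\<inverse> `` {v}))" for v
  have finE: "finite E" using E fin by (meson finite_SigmaI finite_subset)
  have dd: "d s = card (E `` {s})" if "s \<in> S" for s using that by (simp add: d_def)
  have dd': "d t = card (E\<inverse> `` {t})" if "t \<in> T" for t using that disj by (auto simp: d_def)
  have dpos: "d v > 0" if "v \<in> S \<union> T" for v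
    using that dS dT dd dd' finE by (auto simp: card_gt_0_iff finite_Image)
  have fin': "finite (S \<union> T)" "S \<union> T \<noteq> {}" using fin nz by auto
  obtain v where v: "v \<in> S \<union> T" "\<And>u. u \<in> S \<union> T \<Longrightarrow> \<bar>f u\<bar> / d u \<le> \<bar>f v\<bar> / d v"
    using Max_in[of "(\<lambda>v. \<bar>f v\<bar> / d v) ` (S \<union> T)"] Max_ge[of "(\<lambda>v. \<bar>f v\<bar> / d v) ` (S \<union> T)"] fin'
    by (smt (verit) empty_is_image finite_imageI imageE imageI)
  have mx: "\<bar>f u\<bar> * d v \<le> \<bar>f v\<bar> * d u" if "u \<in> S \<union> T" for u
    using v(2)[OF that] dpos[OF that] dpos[OF v(1)] by (simp add: field_simps)
  have fv: "f v \<noteq> 0"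
  proof
    assume "f v = 0"
    obtain u where "u \<in> S \<union> T" "f u \<noteq> 0" using nz by auto
    then show False using mx[of u] dpos[OF v(1)] \<open>f v = 0\<close> by (simp add: mult_le_0_iff)
  qed
  have E': "E\<inverse> \<subseteq> T \<times> S" using E by auto
  have leS: "card (E `` {s}) \<le> n" for s
    using card_mono[of T "E `` {s}"] E fin card by auto
  have leT: "card (E\<inverse> `` {t}) \<le> n" for t
    using card_mono[of S "E\<inverse> `` {t}"] E fin card by auto
  show ?thesis
  proof (cases "v \<in> S")
    case True
    have "\<bar>f t\<bar> * card (E `` {v}) \<le> \<bar>f v\<bar> * card (E\<inverse> `` {t})" if "t \<in> T" for t
      using mx[of t] dd[OF True] dd'[OF that] that by simp
    then show ?thesis
      using edge_bound_side[OF fin E card(2) True fv dS[OF True] eqS[OF True] c k leT] by simp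
  next
    case False
    then have vT: "v \<in> T" using v by auto
    have "\<bar>f s\<bar> * card (E\<inverse> `` {v}) \<le> \<bar>f v\<bar> * card ((E\<inverse>)\<inverse> `` {s})" if "s \<in> S" for s
      using mx[of s] dd'[OF vT] dd[OF that] that by simp
    then show ?thesis
      using edge_bound_side[OF fin(2,1) E' card(1) vT fv dT[OF vT] eqT[OF vT] c k] leS
      by (simp add: card_inverse)
  qed
qed

section \<open>Perturbation of the form of a complete bipartite graph\<close>

text \<open>\<open>N\<close> stands for \<open>card Z\<close>, \<open>m\<close> for the number of
  missing edges in use, and \<open>C\<close> for the coefficient of the gain from \<open>Y\<close>.
  As \<open>N\<close> grows, \<open>C\<close> tends to \<open>k^2\<close>, whereas
  \<open>4 * m\<close> is at least \<open>k^2 + 3\<close>; the margin 3 has to absorb errors of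
  order \<open>1 / N\<close>.\<close>

lemma numeric_bound:
  fixes k N m :: real
  assumes k: "k \<ge> 2" and N: "N \<ge> k^4 + 3 * k^3 + 5 * k^2 + 4 * k + 4"
    and m: "k^2 + 3 \<le> 4 * m" "4 * m \<le> k^2 + 4"
  defines "k' \<equiv> k + k^2 / (2 * N)"
  defines "C \<equiv> k * k' + 4 * k * k'^2 / N"
  shows "C * (1 + 1 / N) < 4 * m * (1 - 6 * m / N)" "C * (2 / N) < 4" "k' \<le> N / 4" "k' > 0" "N > 0"
proof -
  have k2: "k^2 \<ge> 2 * k" using k by (simp add: power2_eq_square)
  have k3: "k^3 \<ge> 2 * k^2" using k by (simp add: power2_eq_square power3_eq_cube)
  have k4: "k^4 \<ge> 2 * k^3" using k by (simp add: power3_eq_cube power4_eq_xxxx)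
  have N72: "N \<ge> 72" using N k k2 k3 k4 by linarith
  then show N0: "N > 0" by simp
  show k'0: "k' > 0" unfolding k'_def using k N0 by (intro add_pos_nonneg) auto
  have Nk: "8 * k \<le> N" using N k k2 k3 k4 by linarith
  have k'1: "k' \<le> k + k / 16"
  proof -
    have "k^2 / (2 * N) \<le> k / 16" using mult_left_mono[OF Nk, of k] k N0
      by (simp add: field_simps power2_eq_square)
    then show ?thesis by (simp add: k'_def)
  qed
  then show "k' \<le> N / 4" using Nk k by linarith
  have "k'^2 \<le> (k + k / 16)^2" using k'1 k'0 by (intro power_mono) auto
  also have "\<dots> = (289 / 256) * k^2" by (simp add: power2_eq_square algebra_simps)
  also have "\<dots> \<le> (5/4) * k^2" using zero_le_power2[of k] by linarith
  finally have "4 * k * k'^2 \<le> 4 * k * ((5/4) * k^2)" using k by (intro mult_left_mono) auto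
  also have "\<dots> = 5 * k^3" by (simp add: power2_eq_square power3_eq_cube)
  finally have "4 * k * k'^2 / N \<le> 5 * k^3 / N" using N0 by (intro divide_right_mono) auto
  moreover have "k * k' = k^2 + (1/2) * k^3 / N" by (simp add: k'_def algebra_simps power2_eq_square power3_eq_cube)
  ultimately have C: "C \<le> k^2 + (11/2) * k^3 / N" unfolding C_def by (simp add: field_simps)
  have k3N: "(11/2) * k^3 \<le> 2 * N" using N k k2 k3 k4 by linarith
  then have k3N': "(11/2) * k^3 / N \<le> 2" using N0 by (simp add: field_simps)
  have "C * (1 + 1 / N) \<le> (k^2 + (11/2) * k^3 / N) * (1 + 1 / N)" using C N0 by (intro mult_right_mono) auto
  also have "\<dots> = k^2 + (11/2) * k^3 / N + (k^2 + (11/2) * k^3 / N) / N" by (simp add: algebra_simps add_divide_distrib)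
  also have "(k^2 + (11/2) * k^3 / N) / N \<le> (k^2 + 2) / N" using k3N' N0 by (intro divide_right_mono) auto
  also have "k^2 + (11/2) * k^3 / N + (k^2 + 2) / N = k^2 + ((11/2) * k^3 + k^2 + 2) / N" by (simp add: add_divide_distrib)
  finally have L: "C * (1 + 1 / N) \<le> k^2 + ((11/2) * k^3 + k^2 + 2) / N" by simp
  have "(4 * m)^2 \<le> (k^2 + 4)^2" using m by (intro power_mono) (use zero_le_power2[of k] in linarith)+
  also have "\<dots> = k^4 + 8 * k^2 + 16" by (simp add: power2_eq_square power4_eq_xxxx algebra_simps)
  finally have m2: "24 * m^2 \<le> (3/2) * k^4 + 12 * k^2 + 24" by (simp add: power2_eq_square)
  \<comment> \<open>The term \<open>24 * m^2\<close> is of order \<open>k^4\<close>, hence the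
    fourth power in the bound on \<open>N\<close>.\<close>
  have "(11/2) * k^3 + k^2 + 2 + ((3/2) * k^4 + 12 * k^2 + 24) < 3 * N" using N k k2 k3 k4 by linarith
  then have "(11/2) * k^3 + k^2 + 2 + 24 * m^2 < 3 * N" using m2 by linarith
  then have "((11/2) * k^3 + k^2 + 2) / N + 24 * m^2 / N < 3" using N0 by (simp add: field_simps)
  moreover have "4 * m * (1 - 6 * m / N) = 4 * m - 24 * m^2 / N" by (simp add: algebra_simps power2_eq_square)
  ultimately show "C * (1 + 1 / N) < 4 * m * (1 - 6 * m / N)" using L m by linarith
  have "C \<le> k^2 + 2" using C k3N' by linarith
  also have "\<dots> < 2 * N" using N k k2 k3 k4 by linarith
  finally show "C * (2 / N) < 4" using N0 by (simp add: field_simps)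
qed

lemma sum_square_deviation:
  fixes f :: "'a \<Rightarrow> real"
  assumes "finite A" "card A = n" "n > 0" "a = sum f A / n"
  shows "(\<Sum>x\<in>A. (f x)^2) = (\<Sum>x\<in>A. (f x - a)^2) + n * a^2"
proof -
  have s: "sum f A = n * a" using assms by simp
  have "(\<Sum>x\<in>A. (f x - a)^2) = (\<Sum>x\<in>A. (f x)^2 - 2 * a * f x + a^2)"
    by (intro sum.cong) (auto simp: power2_diff)
  also have "\<dots> = (\<Sum>x\<in>A. (f x)^2) - 2 * a * sum f A + n * a^2"
    using assms by (simp add: sum.distrib sum_subtractf sum_distrib_left)
  finally show ?thesis using s by (simp add: power2_eq_square)
qed

text \<open>The weight \<open>w\<close> decides how a cross term is shared between the two
  squares.\<close>

lemma two_mult_le_weighted: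
  fixes x y w :: real
  assumes "w > 0"
  shows "2 * (x * y) \<le> w * x^2 + y^2 / w"
proof -
  have "0 \<le> (w * x - y)^2 / w" using assms by simp
  also have "\<dots> = w * x^2 + y^2 / w - 2 * (x * y)"
    using assms by (simp add: field_simps power2_eq_square)
  finally show ?thesis by simp
qed

text \<open>The terms other than the sums over \<open>D\<close> and \<open>Y\<close> are the gap form \<open>(2 n - k) I - Q\<close> of the complete
  bipartite graph on \<open>Z\<close> and \<open>T\<close>. In terms of the means \<open>b\<close>, \<open>a\<close> and the deviations it equals
  \<open>N * VZ + n * VT + (N * b - n * a)\<^sup>2\<close>. Vectors of small gap are thus nearly constant on \<open>Z\<close> and on \<open>T\<close> with
  \<open>a \<approx> b\<close>, so \<open>D\<close> costs about \<open>4 * card D * a\<^sup>2\<close> and \<open>Y\<close> gains about \<open>k\<^sup>2 * a\<^sup>2\<close>.\<close>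

lemma perturbed_form_kernel:
  fixes f :: "'a \<Rightarrow> real"
  assumes fin: "finite Z" "finite T" and Y: "Y \<subseteq> T" "card Y = k" and cT: "card T = n"
    and cZ: "card Z + k = n" and D: "D \<subseteq> Z \<times> T" and mD: "k\<^sup>2 + 3 \<le> 4 * card D" "4 * card D \<le> k\<^sup>2 + 4"
    and k: "k \<ge> 2" and n: "n \<ge> k^4 + 3 * k^3 + 5 * k\<^sup>2 + 5 * k + 4"
    and ineq: "real (card Z) * (\<Sum>z\<in>Z. (f z)\<^sup>2) + real n * (\<Sum>t\<in>T. (f t)\<^sup>2) - 2 * (sum f Z * sum f T)
      + (\<Sum>(z, t)\<in>D. (f z + f t)\<^sup>2) \<le> (k + k\<^sup>2 / (2 * card Z)) * (\<Sum>y\<in>Y. (f y)\<^sup>2)"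
    and v: "v \<in> Z \<union> T"
  shows "f v = 0"
proof -
  define N where "N = real (card Z)"
  define m where "m = real (card D)"
  define \<kappa> where "\<kappa> = real k"
  define k' where "k' = \<kappa> + \<kappa>\<^sup>2 / (2 * N)"
  define C where "C = \<kappa> * k' + 4 * \<kappa> * k'\<^sup>2 / N"
  have nN: "real n = N + \<kappa>" using cZ by (simp add: N_def \<kappa>_def flip: of_nat_add)
  have "real n \<ge> real (k^4 + 3 * k^3 + 5 * k\<^sup>2 + 5 * k + 4)" using n by (simp only: of_nat_le_iff)
  \<comment> \<open>Passing from \<open>n\<close> to \<open>N = n - k\<close> turns the term
    \<open>5 * k\<close> into \<open>4 * k\<close>.\<close>
  then have N: "N \<ge> \<kappa>^4 + 3 * \<kappa>^3 + 5 * \<kappa>\<^sup>2 + 4 * \<kappa> + 4" using nN by (simp add: \<kappa>_def)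
  have "real (k\<^sup>2 + 3) \<le> real (4 * card D)" "real (4 * card D) \<le> real (k\<^sup>2 + 4)"
    using mD by (simp_all only: of_nat_le_iff)
  then have m: "\<kappa>\<^sup>2 + 3 \<le> 4 * m" "4 * m \<le> \<kappa>\<^sup>2 + 4" by (simp_all add: m_def \<kappa>_def)
  have \<kappa>2: "\<kappa> \<ge> 2" using k by (simp add: \<kappa>_def)
  note num = numeric_bound[OF \<kappa>2 N m, folded k'_def, folded C_def]
  have N0: "N > 0" by (rule num)
  have m0: "m > 0" using m zero_le_power2[of \<kappa>] by linarith
  define a where "a = sum f T / n"
  define b where "b = sum f Z / card Z"
  define VT where "VT = (\<Sum>t\<in>T. (f t - a)\<^sup>2)"
  define VZ where "VZ = (\<Sum>z\<in>Z. (f z - b)\<^sup>2)"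
  define r where "r = N * b - real n * a"
  define s where "s = a + b"
  have n0: "n > 0" "card Z > 0" using N0 cZ by (auto simp: N_def)
  have sT: "sum f T = n * a" and sZ: "sum f Z = N * b" using n0 by (auto simp: a_def b_def N_def)
  have T2: "(\<Sum>t\<in>T. (f t)\<^sup>2) = VT + n * a\<^sup>2"
    unfolding VT_def by (rule sum_square_deviation[OF fin(2) cT n0(1) a_def])
  have Z2: "(\<Sum>z\<in>Z. (f z)\<^sup>2) = VZ + N * b\<^sup>2"
    unfolding VZ_def N_def by (rule sum_square_deviation[OF fin(1) refl n0(2) b_def])
  have VT: "(f t - a)\<^sup>2 \<le> VT" if "t \<in> T" for t
    unfolding VT_def using member_le_sum[OF that, of "\<lambda>t. (f t - a)\<^sup>2"] fin by simp
  have VZ: "(f z - b)\<^sup>2 \<le> VZ" if "z \<in> Z" for z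
    unfolding VZ_def using member_le_sum[OF that, of "\<lambda>t. (f t - b)\<^sup>2"] fin by simp
  have VT0: "VT \<ge> 0" and VZ0: "VZ \<ge> 0" by (auto simp: VT_def VZ_def sum_nonneg)
  have main: "N * (VZ + N * b\<^sup>2) + n * (VT + n * a\<^sup>2) - 2 * ((N * b) * (n * a)) = N * VZ + n * VT + r\<^sup>2"
    by (simp add: r_def power2_eq_square algebra_simps)
  \<comment> \<open>With \<open>f z + f t = s + ?u + ?w\<close>, the weights
    \<open>4 * m / N\<close> and \<open>2 * m / N\<close> make the loss over all \<open>m\<close>
    pairs of \<open>D\<close> equal to \<open>N / 4 * VT + N / 2 * VZ\<close>.\<close>
  have edge: "s\<^sup>2 * (1 - 6 * m / N) - N / (4 * m) * VT - N / (2 * m) * VZ \<le> (f z + f t)\<^sup>2"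
    if "(z, t) \<in> D" for z t
  proof -
    have zt: "z \<in> Z" "t \<in> T" using that D by auto
    let ?u = "f t - a" and ?w = "f z - b"
    have "2 * ((- s) * ?u) \<le> (4 * m / N) * (- s)\<^sup>2 + ?u\<^sup>2 / (4 * m / N)"
      using N0 m0 by (intro two_mult_le_weighted) simp
    also have "?u\<^sup>2 / (4 * m / N) = N / (4 * m) * ?u\<^sup>2" by simp
    also have "\<dots> \<le> N / (4 * m) * VT" using VT[OF zt(2)] N0 m0 by (intro mult_left_mono) auto
    finally have 1: "2 * ((- s) * ?u) \<le> 4 * m / N * s\<^sup>2 + N / (4 * m) * VT" by simp
    have "2 * ((- s) * ?w) \<le> (2 * m / N) * (- s)\<^sup>2 + ?w\<^sup>2 / (2 * m / N)"
      using N0 m0 by (intro two_mult_le_weighted) simp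
    also have "?w\<^sup>2 / (2 * m / N) = N / (2 * m) * ?w\<^sup>2" by simp
    also have "\<dots> \<le> N / (2 * m) * VZ" using VZ[OF zt(1)] N0 m0 by (intro mult_left_mono) auto
    finally have 2: "2 * ((- s) * ?w) \<le> 2 * m / N * s\<^sup>2 + N / (2 * m) * VZ" by simp
    have "(f z + f t)\<^sup>2 = s\<^sup>2 - 2 * ((- s) * ?u) - 2 * ((- s) * ?w) + (?u + ?w)\<^sup>2"
      by (simp add: s_def power2_eq_square algebra_simps)
    moreover have "s\<^sup>2 * (1 - 6 * m / N) = s\<^sup>2 - 4 * m / N * s\<^sup>2 - 2 * m / N * s\<^sup>2"
      by (simp add: field_simps)
    ultimately show ?thesis using 1 2 zero_le_power2[of "?u + ?w"] by linarith
  qed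
  have "m * (s\<^sup>2 * (1 - 6 * m / N) - N / (4 * m) * VT - N / (2 * m) * VZ) \<le> (\<Sum>(z, t)\<in>D. (f z + f t)\<^sup>2)"
  proof -
    have "m * (s\<^sup>2 * (1 - 6 * m / N) - N / (4 * m) * VT - N / (2 * m) * VZ) =
      (\<Sum>p\<in>D. s\<^sup>2 * (1 - 6 * m / N) - N / (4 * m) * VT - N / (2 * m) * VZ)" by (simp add: m_def)
    also have "\<dots> \<le> (\<Sum>(z, t)\<in>D. (f z + f t)\<^sup>2)" using edge by (intro sum_mono) auto
    finally show ?thesis .
  qed
  moreover have "m * (s\<^sup>2 * (1 - 6 * m / N) - N / (4 * m) * VT - N / (2 * m) * VZ) =
      m * (1 - 6 * m / N) * s\<^sup>2 - N / 4 * VT - N / 2 * VZ"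
    using m0 N0 by (simp add: field_simps)
  ultimately have sumD: "m * (1 - 6 * m / N) * s\<^sup>2 - N / 4 * VT - N / 2 * VZ \<le> (\<Sum>(z, t)\<in>D. (f z + f t)\<^sup>2)"
    by simp
  \<comment> \<open>The weight \<open>4 / N\<close> charges \<open>N / 2\<close> to the deviations
    on \<open>Y\<close>; after the share of \<open>D\<close>, a quarter of \<open>N * VT\<close>
    survives.\<close>
  have yb: "k' * (f y)\<^sup>2 \<le> k' * a\<^sup>2 + 4 * k'\<^sup>2 / N * a\<^sup>2 + N / 2 * (f y - a)\<^sup>2" for y
  proof -
    let ?u = "f y - a"
    have "2 * ((k' * a) * ?u) \<le> (4 / N) * (k' * a)\<^sup>2 + ?u\<^sup>2 / (4 / N)"
      using N0 by (intro two_mult_le_weighted) simp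
    moreover have "k' * ?u\<^sup>2 \<le> N / 4 * ?u\<^sup>2" using num(3) by (intro mult_right_mono) auto
    moreover have "k' * (f y)\<^sup>2 = k' * a\<^sup>2 + 2 * ((k' * a) * ?u) + k' * ?u\<^sup>2"
      by (simp add: power2_eq_square algebra_simps)
    moreover have "(4 / N) * (k' * a)\<^sup>2 = 4 * k'\<^sup>2 / N * a\<^sup>2" by (simp add: power_mult_distrib)
    moreover have "?u\<^sup>2 / (4 / N) = N / 4 * ?u\<^sup>2" by simp
    ultimately show ?thesis by linarith
  qed
  have "k' * (\<Sum>y\<in>Y. (f y)\<^sup>2) \<le> (\<Sum>y\<in>Y. k' * a\<^sup>2 + 4 * k'\<^sup>2 / N * a\<^sup>2 + N / 2 * (f y - a)\<^sup>2)"
    unfolding sum_distrib_left by (intro sum_mono yb)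
  also have "\<dots> = C * a\<^sup>2 + N / 2 * (\<Sum>y\<in>Y. (f y - a)\<^sup>2)"
    by (simp add: sum.distrib sum_distrib_left Y(2) C_def \<kappa>_def algebra_simps)
  also have "(\<Sum>y\<in>Y. (f y - a)\<^sup>2) \<le> VT" unfolding VT_def using Y(1) fin(2) by (intro sum_mono2) auto
  finally have sumY: "k' * (\<Sum>y\<in>Y. (f y)\<^sup>2) \<le> C * a\<^sup>2 + N / 2 * VT" using N0 by simp
  have "N * VZ + n * VT + r\<^sup>2 + (\<Sum>(z, t)\<in>D. (f z + f t)\<^sup>2) \<le> k' * (\<Sum>y\<in>Y. (f y)\<^sup>2)"
    using ineq main unfolding T2 Z2 sT sZ by (simp add: k'_def N_def \<kappa>_def)
  moreover have "N * VT \<le> n * VT" using nN \<kappa>2 VT0 by (intro mult_right_mono) auto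
  ultimately have key: "N / 2 * VZ + N / 4 * VT + r\<^sup>2 + m * (1 - 6 * m / N) * s\<^sup>2 \<le> C * a\<^sup>2"
    using sumD sumY by linarith
  \<comment> \<open>This expresses \<open>a\<close> by \<open>s\<close> and \<open>r\<close>, whose
    squares stand on the left of \<open>key\<close>.\<close>
  have aeq: "(2 * N + \<kappa>) * a = N * s - r" using nN by (simp add: s_def r_def algebra_simps)
  have "(2 * N)\<^sup>2 * a\<^sup>2 \<le> (2 * N + \<kappa>)\<^sup>2 * a\<^sup>2"
    using N0 \<kappa>2 by (intro mult_right_mono power_mono) auto
  also have "\<dots> = (N * s - r)\<^sup>2" using aeq by (simp flip: power_mult_distrib)
  also have "\<dots> = N\<^sup>2 * s\<^sup>2 + r\<^sup>2 + 2 * ((- N * s) * r)" by (simp add: power2_eq_square algebra_simps)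
  also have "2 * ((- N * s) * r) \<le> (1 / N) * (- N * s)\<^sup>2 + r\<^sup>2 / (1 / N)"
    using N0 by (intro two_mult_le_weighted) simp
  also have "(1 / N) * (- N * s)\<^sup>2 + r\<^sup>2 / (1 / N) = N * s\<^sup>2 + N * r\<^sup>2"
    using N0 by (simp add: power2_eq_square)
  finally have "4 * N\<^sup>2 * a\<^sup>2 \<le> N\<^sup>2 * s\<^sup>2 + r\<^sup>2 + (N * s\<^sup>2 + N * r\<^sup>2)" by (simp add: power_mult_distrib)
  moreover have "r\<^sup>2 * 1 \<le> r\<^sup>2 * N" using N \<kappa>2 zero_le_power[of \<kappa> 4] zero_le_power[of \<kappa> 3] zero_le_power2[of \<kappa>]
    by (intro mult_left_mono) (linarith | simp)+
  moreover have "N\<^sup>2 * ((1 + 1 / N) * s\<^sup>2 + (2 / N) * r\<^sup>2) = N\<^sup>2 * s\<^sup>2 + N * s\<^sup>2 + 2 * N * r\<^sup>2"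
  proof -
    have "N\<^sup>2 * (1 + 1 / N) = N\<^sup>2 + N" "N\<^sup>2 * (2 / N) = 2 * N"
      using N0 by (simp_all add: power2_eq_square distrib_left)
    then show ?thesis
      by (simp only: distrib_left[of "N\<^sup>2"] mult.assoc[symmetric]) (simp only: distrib_right)
  qed
  ultimately have "4 * N\<^sup>2 * a\<^sup>2 \<le> N\<^sup>2 * ((1 + 1 / N) * s\<^sup>2 + (2 / N) * r\<^sup>2)"
    by (simp add: mult.commute)
  then have "N\<^sup>2 * (4 * a\<^sup>2) \<le> N\<^sup>2 * ((1 + 1 / N) * s\<^sup>2 + (2 / N) * r\<^sup>2)" by (simp add: mult.commute mult.left_commute)
  then have a4: "4 * a\<^sup>2 \<le> (1 + 1 / N) * s\<^sup>2 + (2 / N) * r\<^sup>2"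
    using N0 by simp
  have C0: "C \<ge> 0" unfolding C_def using \<kappa>2 num(4) N0 by (intro add_nonneg_nonneg) auto
  define C1 where "C1 = C * (1 + 1 / N)"
  define C2 where "C2 = C * (2 / N)"
  define M where "M = 4 * m * (1 - 6 * m / N)"
  have "C * (4 * a\<^sup>2) \<le> C * ((1 + 1 / N) * s\<^sup>2 + (2 / N) * r\<^sup>2)"
    using a4 C0 by (rule mult_left_mono)
  also have "\<dots> = C1 * s\<^sup>2 + C2 * r\<^sup>2"
    unfolding C1_def C2_def mult.assoc by (rule distrib_left)
  finally have "4 * (C * a\<^sup>2) \<le> C1 * s\<^sup>2 + C2 * r\<^sup>2" by simp
  moreover have "4 * (m * (1 - 6 * m / N) * s\<^sup>2) = M * s\<^sup>2" unfolding M_def by (simp only: mult.assoc)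
  moreover have "N / 2 * VZ = N * VZ / 2" "N / 4 * VT = N * VT / 4" by simp_all
  \<comment> \<open>This is \<open>key\<close> times 4 with \<open>a4\<close> inserted. By
    \<open>numeric_bound\<close> all coefficients are positive, so every term must vanish.\<close>
  ultimately have key2: "2 * (N * VZ) + N * VT + (4 - C2) * r\<^sup>2 + (M - C1) * s\<^sup>2 \<le> 0"
    using key unfolding left_diff_distrib by linarith
  have lt: "C1 < M" "C2 < 4" using num(1,2) by (simp_all add: C1_def C2_def M_def)
  have p: "N * VZ \<ge> 0" "N * VT \<ge> 0" "(4 - C2) * r\<^sup>2 \<ge> 0" "(M - C1) * s\<^sup>2 \<ge> 0"
    using VT0 VZ0 N0 lt by (auto intro!: mult_nonneg_nonneg)
  then have "N * VZ = 0" "N * VT = 0" "(4 - C2) * r\<^sup>2 = 0" "(M - C1) * s\<^sup>2 = 0"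
    using key2 by linarith+
  then have z: "VZ = 0" "VT = 0" "r = 0" "s = 0" using N0 lt by auto
  have "a\<^sup>2 \<le> 0" using a4 z by simp
  then have a: "a = 0" by simp
  then have b: "b = 0" using z(4) by (simp add: s_def)
  show ?thesis using v VT[of v] VZ[of v] z a b by auto
qed

section \<open>Energy of an eigenvector and the number of missing edges\<close>

text \<open>The square splits into \<open>f s * (f s + f t)\<close> and
  \<open>f t * (f t + f s)\<close>; grouping each part by its endpoint produces the eigenvalue
  equations.\<close>

lemma energy_identity:
  fixes f :: "'a \<Rightarrow> real"
  assumes fin: "finite S" "finite T" and E: "E \<subseteq> S \<times> T"
    and eqS: "\<And>s. s \<in> S \<Longrightarrow> (\<Sum>t\<in>E `` {s}. f s + f t) = c * f s"
    and eqT: "\<And>t. t \<in> T \<Longrightarrow> (\<Sum>s\<in>E\<inverse> `` {t}. f t + f s) = c * f t"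
  shows "(\<Sum>(s, t)\<in>E. (f s + f t)\<^sup>2) = c * (\<Sum>s\<in>S. (f s)\<^sup>2) + c * (\<Sum>t\<in>T. (f t)\<^sup>2)"
proof -
  have finE: "finite E" using E fin by (meson finite_SigmaI finite_subset)
  have ES: "E = (SIGMA s:S. E `` {s})" and ET: "E\<inverse> = (SIGMA t:T. E\<inverse> `` {t})" using E by auto
  have "(\<Sum>(s, t)\<in>E. f s * (f s + f t)) = (\<Sum>s\<in>S. \<Sum>t\<in>E `` {s}. f s * (f s + f t))"
    by (subst ES, rule sum.Sigma[symmetric]) (use fin finE in \<open>auto intro: finite_Image\<close>)
  also have "\<dots> = (\<Sum>s\<in>S. f s * (c * f s))" by (simp add: eqS flip: sum_distrib_left)
  finally have 1: "(\<Sum>(s, t)\<in>E. f s * (f s + f t)) = c * (\<Sum>s\<in>S. (f s)\<^sup>2)"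
    by (simp add: sum_distrib_left power2_eq_square mult.left_commute)
  have "(\<Sum>(s, t)\<in>E. f t * (f t + f s)) = (\<Sum>(t, s)\<in>E\<inverse>. f t * (f t + f s))"
    by (rule sum.reindex_bij_witness[of _ prod.swap prod.swap]) auto
  also have "\<dots> = (\<Sum>t\<in>T. \<Sum>s\<in>E\<inverse> `` {t}. f t * (f t + f s))"
    by (subst ET, rule sum.Sigma[symmetric]) (use fin finE in \<open>auto intro: finite_Image\<close>)
  also have "\<dots> = (\<Sum>t\<in>T. f t * (c * f t))" by (simp add: eqT flip: sum_distrib_left)
  finally have 2: "(\<Sum>(s, t)\<in>E. f t * (f t + f s)) = c * (\<Sum>t\<in>T. (f t)\<^sup>2)"
    by (simp add: sum_distrib_left power2_eq_square mult.left_commute)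
  have "(\<Sum>(s, t)\<in>E. (f s + f t)\<^sup>2) = (\<Sum>(s, t)\<in>E. f s * (f s + f t)) + (\<Sum>(s, t)\<in>E. f t * (f t + f s))"
    unfolding sum.distrib[symmetric] by (intro sum.cong) (auto simp: power2_eq_square algebra_simps)
  then show ?thesis using 1 2 by simp
qed

lemma energy_complete:
  fixes f :: "'a \<Rightarrow> real"
  assumes "finite A" "finite B"
  shows "(\<Sum>(s, t)\<in>A \<times> B. (f s + f t)\<^sup>2) = card B * (\<Sum>s\<in>A. (f s)\<^sup>2) + card A * (\<Sum>t\<in>B. (f t)\<^sup>2) + 2 * (sum f A * sum f B)"
proof -
  have "(\<Sum>(s, t)\<in>A \<times> B. (f s + f t)\<^sup>2) = (\<Sum>s\<in>A. \<Sum>t\<in>B. (f s)\<^sup>2 + (f t)\<^sup>2 + 2 * (f s * f t))"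
    by (simp add: sum.cartesian_product power2_sum mult.assoc)
  also have "\<dots> = card B * (\<Sum>s\<in>A. (f s)\<^sup>2) + card A * (\<Sum>t\<in>B. (f t)\<^sup>2) + 2 * (\<Sum>s\<in>A. \<Sum>t\<in>B. f s * f t)"
    by (simp add: sum.distrib sum_distrib_left)
  finally show ?thesis by (simp add: sum_product)
qed

text \<open>With too many missing edges, some of them are fixed as \<open>D\<close>. Then
  \<open>E\<close> lies in \<open>(?Z \<times> T - D) \<union> X \<times> Y\<close>, and comparing
  energies leads to \<open>perturbed_form_kernel\<close>. What remains is an eigenvector supported
  on \<open>X\<close>, whose eigenvalue would be a vertex degree, hence at most
  \<open>n\<close>.\<close>

lemma few_missing_edges:
  fixes f :: "'a \<Rightarrow> real"
  assumes fin: "finite S" "finite T" and E: "E \<subseteq> S \<times> T" and card: "card S = n" "card T = n"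
    and eqS: "\<And>s. s \<in> S \<Longrightarrow> (\<Sum>t\<in>E `` {s}. f s + f t) = c * f s"
    and eqT: "\<And>t. t \<in> T \<Longrightarrow> (\<Sum>s\<in>E\<inverse> `` {t}. f t + f s) = c * f t"
    and c: "c \<ge> 2 * real n - real k" and k: "k \<ge> 2"
    and n: "n \<ge> k^4 + 3 * k^3 + 5 * k\<^sup>2 + 5 * k + 4"
    and nz: "\<exists>v\<in>S \<union> T. f v \<noteq> 0"
    and X: "X \<subseteq> S" "card X = k" and Y: "Y \<subseteq> T" "card Y = k" and XY: "E \<inter> X \<times> (T - Y) = {}"
  shows "card ((S - X) \<times> T - E) \<le> k\<^sup>2 div 4"
proof (rule ccontr)
  let ?Z = "S - X"
  let ?M = "?Z \<times> T - E"
  define N where "N = real (card ?Z)"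
  assume "\<not> ?thesis"
  then have "k\<^sup>2 div 4 + 1 \<le> card ?M" by simp
  \<comment> \<open>Exactly one edge too many is taken, since \<open>perturbed_form_kernel\<close>
    also bounds \<open>card D\<close> from above.\<close>
  then obtain D where D: "D \<subseteq> ?M" "card D = k\<^sup>2 div 4 + 1" "finite D"
    by (rule obtain_subset_with_card_n)
  have finX: "finite X" and finY: "finite Y" and finZ: "finite ?Z" using X Y fin finite_subset by auto
  have cZ: "card ?Z + k = n" using X card fin card_mono[OF fin(1) X(1)] by (simp add: card_Diff_subset finX)
  have kn: "k < card ?Z" using n cZ k by linarith
  then have N0: "N > 0" by (simp add: N_def)
  have nN: "real n = N + k" using cZ by (simp add: N_def flip: of_nat_add)
  let ?sq = "\<lambda>A. \<Sum>x\<in>A. (f x)\<^sup>2"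
  let ?en = "\<lambda>R. \<Sum>(s, t)\<in>R. (f s + f t)\<^sup>2"
  have finE: "finite E" using E fin by (meson finite_SigmaI finite_subset)
  have sub: "E \<subseteq> (?Z \<times> T - D) \<union> X \<times> Y" using E XY D by auto
  have "?en E \<le> ?en ((?Z \<times> T - D) \<union> X \<times> Y)"
    using sub finZ finX finY fin by (intro sum_mono2) auto
  also have "\<dots> = ?en (?Z \<times> T - D) + ?en (X \<times> Y)"
    using finZ finX finY fin by (intro sum.union_disjoint) auto
  also have "?en (?Z \<times> T - D) = ?en (?Z \<times> T) - ?en D"
    using finZ fin D by (intro sum_diff) auto
  finally have en: "?en E \<le> ?en (?Z \<times> T) - ?en D + ?en (X \<times> Y)" by simp
  have enZ: "?en (?Z \<times> T) = n * ?sq ?Z + N * ?sq T + 2 * (sum f ?Z * sum f T)"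
    using energy_complete[OF finZ fin(2), of f] card by (simp add: N_def)
  have enX: "?en (X \<times> Y) \<le> (2 * N + k) * ?sq X + (k + k\<^sup>2 / (2 * N)) * ?sq Y"
  proof -
    \<comment> \<open>Summed over the \<open>k\<close> vertices of \<open>Y\<close>, the weight
      \<open>2 * N / k\<close> gives \<open>(f x)\<^sup>2\<close> the coefficient
      \<open>2 * N + k\<close>, which is \<open>2 * n - k\<close>; so the terms of \<open>X\<close>
      cancel against the eigenvalue side.\<close>
    have "?en (X \<times> Y) \<le> (\<Sum>(x, y)\<in>X \<times> Y. (2 * N / k + 1) * (f x)\<^sup>2 + (1 + k / (2 * N)) * (f y)\<^sup>2)"
    proof (intro sum_mono, clarify)
      fix x y
      have "2 * (f x * f y) \<le> 2 * N / k * (f x)\<^sup>2 + (f y)\<^sup>2 / (2 * N / k)"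
        using N0 k by (intro two_mult_le_weighted) simp
      moreover have "(f y)\<^sup>2 / (2 * N / k) = k / (2 * N) * (f y)\<^sup>2" by simp
      ultimately show "(f x + f y)\<^sup>2 \<le> (2 * N / k + 1) * (f x)\<^sup>2 + (1 + k / (2 * N)) * (f y)\<^sup>2"
        by (simp only: power2_sum distrib_right)
    qed
    also have "\<dots> = k * ((2 * N / k + 1) * ?sq X) + k * ((1 + k / (2 * N)) * ?sq Y)"
      by (simp add: sum.distrib sum_distrib_left X(2) Y(2) flip: sum.cartesian_product)
    also have "k * ((2 * N / k + 1) * ?sq X) = (2 * N + k) * ?sq X" using k by (simp add: field_simps)
    also have "k * ((1 + k / (2 * N)) * ?sq Y) = (k + k\<^sup>2 / (2 * N)) * ?sq Y"
      by (simp add: power2_eq_square algebra_simps)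
    finally show ?thesis .
  qed
  have sqS: "?sq S = ?sq X + ?sq ?Z" using sum.subset_diff[OF X(1) fin(1), of "\<lambda>x. (f x)\<^sup>2"] by simp
  have c': "2 * N + k \<le> c" using c nN by simp
  have "(2 * N + k) * (?sq S + ?sq T) \<le> c * (?sq S + ?sq T)"
    using c' by (intro mult_right_mono add_nonneg_nonneg sum_nonneg) auto
  also have "\<dots> = ?en E" using energy_identity[OF fin E eqS eqT] by (simp add: distrib_left)
  finally have "(2 * N + k) * ?sq X + (2 * N + k) * ?sq ?Z + (2 * N + k) * ?sq T \<le> ?en E"
    unfolding sqS by (simp only: distrib_left)
  moreover have "(2 * N + k) * ?sq ?Z - n * ?sq ?Z = N * ?sq ?Z" "(2 * N + k) * ?sq T - N * ?sq T = n * ?sq T"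
    using nN by (simp_all add: algebra_simps)
  ultimately have ineq: "real (card ?Z) * ?sq ?Z + real n * ?sq T - 2 * (sum f ?Z * sum f T) + ?en D
    \<le> (k + k\<^sup>2 / (2 * card ?Z)) * ?sq Y"
    using en enZ enX by (simp add: N_def)
  \<comment> \<open>Squares are 0 or 1 modulo 4, so \<open>4 * card D\<close> is
    \<open>k\<^sup>2 + 4\<close> or \<open>k\<^sup>2 + 3\<close>.\<close>
  have sqm: "k\<^sup>2 mod 4 = 0 \<or> k\<^sup>2 mod 4 = 1"
  proof (cases "even k")
    case True then show ?thesis by (auto simp: power2_eq_square elim!: evenE)
  next
    case False
    then obtain j where "k = 2 * j + 1" by (elim oddE)
    then have "k\<^sup>2 = 4 * (j\<^sup>2 + j) + 1" by (simp add: power2_eq_square algebra_simps)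
    then show ?thesis by simp
  qed
  have "k\<^sup>2 = 4 * (k\<^sup>2 div 4) + k\<^sup>2 mod 4" by simp
  then have mD: "k\<^sup>2 + 3 \<le> 4 * card D" "4 * card D \<le> k\<^sup>2 + 4" using sqm D(2) by linarith+
  have DZ: "D \<subseteq> ?Z \<times> T" using D by auto
  have zero: "f v = 0" if "v \<in> ?Z \<union> T" for v
    by (rule perturbed_form_kernel[OF finZ fin(2) Y card(2) cZ DZ mD k n _ that]) (use ineq in simp)
  obtain x where x: "x \<in> S \<union> T" "f x \<noteq> 0" using nz by auto
  then have xX: "x \<in> X" "x \<in> S" using zero X by auto
  have ET: "E `` {x} \<subseteq> T" using E by auto
  have "(\<Sum>t\<in>E `` {x}. f x + f t) = (\<Sum>t\<in>E `` {x}. f x)"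
    using zero ET by (intro sum.cong) auto
  then have "c * f x = card (E `` {x}) * f x" using eqS[OF xX(2)] by simp
  then have "c = real (card (E `` {x}))" using x(2) by simp
  moreover have "card (E `` {x}) \<le> n" using card_mono[OF fin(2) ET] card by simp
  ultimately show False using c' nN N0 by simp
qed

subsection \<open>The exceptional family\<close>

definition bip_rel :: "'a ugraph \<Rightarrow> 'a set \<Rightarrow> 'a set \<Rightarrow> ('a \<times> 'a) set" where
  "bip_rel G S T = {(s, t). s \<in> S \<and> t \<in> T \<and> {s, t} \<in> edges G}"

lemma bip_rel_converse: "(bip_rel G S T)\<inverse> = bip_rel G T S"
  by (auto simp: bip_rel_def insert_commute)

lemma bipartition_swap: "bipartition G S T \<Longrightarrow> bipartition G T S"
  unfolding bipartition_def by (metis Int_commute Un_commute insert_commute)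

text \<open>In the concrete \<open>B_graph\<close> the sets \<open>part_X\<close> and
  \<open>part_W\<close> are initial segments; such numberings send \<open>X\<close> and
  \<open>T - Y\<close> onto them.\<close>

lemma bij_betw_lessThan_prefix:
  assumes "finite S" "A \<subseteq> S" "card S = n" "card A = j"
  obtains \<phi> where "bij_betw \<phi> S {..<n}" "\<And>x. x \<in> S \<Longrightarrow> \<phi> x < j \<longleftrightarrow> x \<in> A"
proof -
  have finA: "finite A" using assms finite_subset by blast
  have jn: "j \<le> n" using card_mono[OF assms(1,2)] assms by simp
  obtain g where g: "bij_betw g A {..<j}"
    using finite_same_card_bij[OF finA, of "{..<j}"] assms by auto
  have "card (S - A) = card {j..<n}" using assms finA by (simp add: card_Diff_subset)
  then obtain h where h: "bij_betw h (S - A) {j..<n}"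
    using finite_same_card_bij[of "S - A" "{j..<n}"] assms by auto
  let ?f = "\<lambda>x. if x \<in> A then g x else h x"
  have "bij_betw ?f A {..<j}" using g by (subst bij_betw_cong[of _ _ g]) auto
  moreover have "bij_betw ?f (S - A) {j..<n}" using h by (subst bij_betw_cong[of _ _ h]) auto
  ultimately have "bij_betw ?f (A \<union> (S - A)) ({..<j} \<union> {j..<n})" by (rule bij_betw_combine) auto
  moreover have "A \<union> (S - A) = S" "{..<j} \<union> {j..<n} = {..<n}" using assms jn by auto
  ultimately have "bij_betw ?f S {..<n}" by simp
  moreover have "?f x < j \<longleftrightarrow> x \<in> A" if "x \<in> S" for x
    using that bij_betwE[OF g] bij_betwE[OF h] by (cases "x \<in> A") force+
  ultimately show ?thesis by (rule that)
qed

text \<open>The degree bound joins every vertex of \<open>X\<close> to all of \<open>Y\<close>. All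
  other missing edges avoid \<open>X\<close>, so their images form an admissible
  \<open>E'\<close>.\<close>

lemma in_B1_family_of_block:
  fixes G :: "'a ugraph"
  assumes fin: "finite S" "finite T" and bip: "bipartition G S T" and card: "card S = n" "card T = n"
    and X: "X \<subseteq> S" "card X = k" and Y: "Y \<subseteq> T" "card Y = k"
    and XY: "bip_rel G S T \<inter> X \<times> (T - Y) = {}"
    and deg: "\<And>x. x \<in> X \<Longrightarrow> k \<le> card (bip_rel G S T `` {x})"
    and miss: "card ((S - X) \<times> T - bip_rel G S T) \<le> k\<^sup>2 div 4"
  shows "in_B1_family G n k"
proof -
  let ?E = "bip_rel G S T"
  let ?M = "(S - X) \<times> T - ?E"
  have finX: "finite X" and finY: "finite Y" using X Y fin finite_subset by auto
  have EX: "?E `` {x} = Y" if "x \<in> X" for x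
  proof (rule card_subset_eq[OF finY])
    show sub: "?E `` {x} \<subseteq> Y" using XY that by (force simp: bip_rel_def)
    show "card (?E `` {x}) = card Y"
      using deg[OF that] card_mono[OF finY sub] Y(2) by linarith
  qed
  obtain \<phi> where \<phi>: "bij_betw \<phi> S {..<n}" "\<And>x. x \<in> S \<Longrightarrow> \<phi> x < k \<longleftrightarrow> x \<in> X"
    using bij_betw_lessThan_prefix[OF fin(1) X(1) card(1) X(2)] by blast
  have "card (T - Y) = n - k" using Y card finY by (simp add: card_Diff_subset)
  then obtain \<psi> where \<psi>: "bij_betw \<psi> T {..<n}" "\<And>x. x \<in> T \<Longrightarrow> \<psi> x < n - k \<longleftrightarrow> x \<in> T - Y"
    using bij_betw_lessThan_prefix[OF fin(2) Diff_subset card(2)] by blast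
  have disj: "S \<inter> T = {}" and V: "verts G = S \<union> T" using bip by (auto simp: bipartition_def)
  define F where "F v = (if v \<in> S then Inl (\<phi> v) else Inr (\<psi> v))" for v
  have FS: "F s = Inl (\<phi> s)" if "s \<in> S" for s using that by (simp add: F_def)
  have FT: "F t = Inr (\<psi> t)" if "t \<in> T" for t using that disj by (auto simp: F_def)
  have "bij_betw (Inl \<circ> \<phi>) S (part_S n)"
    unfolding part_S_def by (rule bij_betw_trans[OF \<phi>(1)]) (simp add: bij_betw_def)
  then have bS: "bij_betw F S (part_S n)" using FS by (subst bij_betw_cong[of _ _ "Inl \<circ> \<phi>"]) auto
  have "bij_betw (Inr \<circ> \<psi>) T (part_T n)"
    unfolding part_T_def by (rule bij_betw_trans[OF \<psi>(1)]) (simp add: bij_betw_def)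
  then have bT: "bij_betw F T (part_T n)" using FT by (subst bij_betw_cong[of _ _ "Inr \<circ> \<psi>"]) auto
  have bF: "bij_betw F (S \<union> T) (part_S n \<union> part_T n)"
    by (rule bij_betw_combine[OF bS bT]) (auto simp: part_S_def part_T_def)
  have \<phi>n: "\<phi> s < n" if "s \<in> S" for s using that bij_betwE[OF \<phi>(1)] by auto
  have \<psi>n: "\<psi> t < n" if "t \<in> T" for t using that bij_betwE[OF \<psi>(1)] by auto
  have \<phi>i: "\<phi> s = \<phi> s' \<longleftrightarrow> s = s'" if "s \<in> S" "s' \<in> S" for s s'
    using that bij_betw_imp_inj_on[OF \<phi>(1)] by (auto simp: inj_on_def)
  have \<psi>i: "\<psi> t = \<psi> t' \<longleftrightarrow> t = t'" if "t \<in> T" "t' \<in> T" for t t'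
    using that bij_betw_imp_inj_on[OF \<psi>(1)] by (auto simp: inj_on_def)
  have B: "{Inl i, Inr j} \<in> edges (B_graph k n) \<longleftrightarrow> i < n \<and> j < n \<and> \<not> (i < k \<and> j < n - k)" for i j
    by (auto simp: B_graph_def delete_edges_def complete_bipartite_def part_S_def part_T_def
        part_X_def part_W_def doubleton_eq_iff)
  have BL: "{Inl i, Inl j} \<notin> edges (B_graph k n)" "{Inr i, Inr j} \<notin> edges (B_graph k n)" for i j
    by (auto simp: B_graph_def delete_edges_def complete_bipartite_def part_S_def part_T_def
        doubleton_eq_iff)
  define E' where "E' = (\<lambda>(s, t). {F s, F t}) ` ?M"
  have "E' \<subseteq> E1 k n"
  proof
    fix e assume "e \<in> E'"
    then obtain s t where st: "s \<in> S" "s \<notin> X" "t \<in> T" "e = {Inl (\<phi> s), Inr (\<psi> t)}"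
      using FS FT by (auto simp: E'_def)
    have ns: "\<not> \<phi> s < k" using \<phi>(2) st by simp
    then have "e \<in> edges (B_graph k n)" using st B \<phi>n \<psi>n by simp
    moreover have "Inl (\<phi> s) \<in> part_Z k n" using ns \<phi>n[OF st(1)] by (auto simp: part_Z_def part_S_def part_X_def)
    moreover have "Inr (\<psi> t) \<in> part_Y k n \<union> part_W k n" using \<psi>n[OF st(3)] by (auto simp: part_Y_def part_T_def)
    ultimately show "e \<in> E1 k n" using st(4) by (auto simp: E1_def)
  qed
  moreover have "card E' \<le> k\<^sup>2 div 4"
    unfolding E'_def using card_image_le[of ?M "\<lambda>(s, t). {F s, F t}"] miss fin by simp
  ultimately have H: "delete_edges (B_graph k n) E' \<in> B1_family n k" unfolding B1_family_def by blast
  let ?H = "delete_edges (B_graph k n) E'"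
  have eH: "edges ?H = edges (B_graph k n) - E'" by (simp add: delete_edges_def)
  have st: "{s, t} \<in> edges G \<longleftrightarrow> {F s, F t} \<in> edges ?H" if s: "s \<in> S" and t: "t \<in> T" for s t
  proof -
    have "{F s, F t} \<in> E' \<longleftrightarrow> (s, t) \<in> ?M"
    proof
      assume "{F s, F t} \<in> E'"
      then obtain s' t' where st': "(s', t') \<in> ?M" "{F s, F t} = {F s', F t'}" by (auto simp: E'_def)
      then have "s' \<in> S" "t' \<in> T" by auto
      then have "s = s'" "t = t'" using st'(2) s t FS FT \<phi>i \<psi>i by (auto simp: doubleton_eq_iff)
      then show "(s, t) \<in> ?M" using st' by simp
    qed (auto simp: E'_def)
    moreover have "{F s, F t} \<in> edges (B_graph k n) \<longleftrightarrow> \<not> (s \<in> X \<and> t \<notin> Y)"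
      using B FS[OF s] FT[OF t] \<phi>n[OF s] \<psi>n[OF t] \<phi>(2)[OF s] \<psi>(2)[OF t] t by simp
    moreover have "{s, t} \<in> edges G \<longleftrightarrow> (s, t) \<in> ?E" using s t by (simp add: bip_rel_def)
    moreover have "s \<in> X \<Longrightarrow> (s, t) \<in> ?E \<longleftrightarrow> t \<in> Y" using EX[of s] by auto
    ultimately show ?thesis using s t eH by auto
  qed
  \<comment> \<open>\<open>isomorphic\<close> compares all pairs of vertices, also those inside one
    side.\<close>
  have ss: "{u, v} \<notin> edges G" if "u \<in> S \<and> v \<in> S \<or> u \<in> T \<and> v \<in> T" for u v
    using bip that disj by (auto simp: bipartition_def doubleton_eq_iff dest!: bspec)
  have "{u, v} \<in> edges G \<longleftrightarrow> {F u, F v} \<in> edges ?H" if uv: "u \<in> S \<union> T" "v \<in> S \<union> T" for u v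
  proof -
    consider "u \<in> S" "v \<in> T" | "u \<in> T" "v \<in> S" | "u \<in> S" "v \<in> S" | "u \<in> T" "v \<in> T" using uv by auto
    then show ?thesis
    proof cases
      case 1 then show ?thesis using st by simp
    next
      case 2 then show ?thesis using st[of v u] by (simp add: insert_commute)
    next
      case 3 then show ?thesis using ss[of u v] FS BL eH by simp
    next
      case 4 then show ?thesis using ss[of u v] FT BL eH by simp
    qed
  qed
  moreover have "verts ?H = part_S n \<union> part_T n"
    by (simp add: delete_edges_def B_graph_def complete_bipartite_def)
  ultimately have "isomorphic G ?H" unfolding isomorphic_def V using bF by auto
  then show ?thesis unfolding in_B1_family_def using H by blast
qed

section \<open>From the signless Laplacian to equations on neighbourhoods\<close>

lemma vdegree_bip_rel:
  assumes bip: "bipartition G S T" and s: "s \<in> S"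
  shows "vdegree G s = card (bip_rel G S T `` {s})"
proof -
  have disj: "S \<inter> T = {}" using bip by (simp add: bipartition_def)
  have "{e \<in> edges G. s \<in> e} = (\<lambda>t. {s, t}) ` (bip_rel G S T `` {s})"
  proof (intro equalityI subsetI)
    fix e assume e: "e \<in> {e \<in> edges G. s \<in> e}"
    then obtain s' t where st: "s' \<in> S" "t \<in> T" "e = {s', t}" using bip by (auto simp: bipartition_def)
    then have "s' = s" using e s disj by auto
    then show "e \<in> (\<lambda>t. {s, t}) ` (bip_rel G S T `` {s})" using e st by (auto simp: bip_rel_def)
  qed (auto simp: bip_rel_def)
  moreover have "inj_on (\<lambda>t. {s, t}) (bip_rel G S T `` {s})" by (auto simp: inj_on_def doubleton_eq_iff)
  ultimately show ?thesis unfolding vdegree_def by (simp add: card_image)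
qed

text \<open>The degree term supplies one copy of \<open>f s\<close> per neighbour, so a matrix row
  becomes the sum over neighbours in which the spectral lemmas state the eigenvalue
  equation.\<close>

lemma signless_laplacian_row:
  fixes f :: "'a \<Rightarrow> real"
  assumes bip: "bipartition G S T" and fin: "finite S" "finite T" and s: "s \<in> S"
  shows "real (vdegree G s) * f s + (\<Sum>u\<in>verts G. if {s, u} \<in> edges G then f u else 0)
    = (\<Sum>t\<in>bip_rel G S T `` {s}. f s + f t)"
proof -
  have disj: "S \<inter> T = {}" and V: "verts G = S \<union> T" using bip by (auto simp: bipartition_def)
  have ns: "{s, u} \<notin> edges G" if "u \<in> S" for u
    using bip that disj s by (auto simp: bipartition_def doubleton_eq_iff dest!: bspec)
  have "(\<Sum>u\<in>verts G. if {s, u} \<in> edges G then f u else 0) = sum f {u \<in> verts G. {s, u} \<in> edges G}"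
    using fin V by (intro sum.inter_filter[symmetric]) simp
  also have "{u \<in> verts G. {s, u} \<in> edges G} = bip_rel G S T `` {s}"
    using ns s by (auto simp: bip_rel_def V)
  finally show ?thesis by (simp add: vdegree_bip_rel[OF bip s] sum.distrib)
qed

text \<open>\<open>q_index\<close> is a \<open>Max\<close>, so an eigenvector for it is available
  once the set of eigenvalues is shown to be finite and nonempty.\<close>

lemma q_index_eigenvector:
  assumes bip: "bipartition G S T" and fin: "finite S" "finite T" and ne: "S \<noteq> {}"
  obtains f :: "'a \<Rightarrow> real" where "\<exists>v\<in>S \<union> T. f v \<noteq> 0"
    "\<And>s. s \<in> S \<Longrightarrow> (\<Sum>t\<in>bip_rel G S T `` {s}. f s + f t) = q_index G * f s"
    "\<And>t. t \<in> T \<Longrightarrow> (\<Sum>s\<in>bip_rel G T S `` {t}. f t + f s) = q_index G * f t"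
proof -
  have disj: "S \<inter> T = {}" and V: "verts G = S \<union> T" using bip by (auto simp: bipartition_def)
  have vl: "distinct (vertex_list G)" "set (vertex_list G) = S \<union> T"
    using vertex_list[of G] fin V by auto
  let ?Q = "signless_laplacian G (vertex_list G)"
  define EV where "EV c f \<longleftrightarrow> (\<exists>v\<in>S \<union> T. f v \<noteq> (0 :: real)) \<and>
    (\<forall>s\<in>S. (\<Sum>t\<in>bip_rel G S T `` {s}. f s + f t) = c * f s) \<and>
    (\<forall>t\<in>T. (\<Sum>s\<in>bip_rel G T S `` {t}. f t + f s) = c * f t)" for c f
  have ev: "eigenvalue ?Q c \<longleftrightarrow> (\<exists>f. EV c f)" for c
    unfolding EV_def eigenvalue_signless_laplacian_iff[OF vl(1)] vl(2)
    using signless_laplacian_row[OF bip fin] signless_laplacian_row[OF bipartition_swap[OF bip] fin(2,1)] V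
    by (simp add: ball_Un)
  have carrier: "?Q \<in> carrier_mat (length (vertex_list G)) (length (vertex_list G))"
    by (simp add: signless_laplacian_def degree_matrix_def adjacency_matrix_def)
  have "char_poly ?Q \<noteq> 0" using degree_monic_char_poly[OF carrier] by auto
  then have finite: "finite {c. eigenvalue ?Q c}"
    using poly_roots_finite eigenvalue_root_char_poly[OF carrier] by simp
  \<comment> \<open>Max is meaningful because the signed indicator of the bipartition is an eigenvector for 0.\<close>
  have "EV 0 (\<lambda>v. if v \<in> S then 1 else - 1)"
    unfolding EV_def
  proof (intro conjI ballI)
    show "\<exists>v\<in>S \<union> T. (if v \<in> S then 1 else - 1) \<noteq> (0 :: real)" using ne by auto
  next
    fix s assume "s \<in> S"
    then show "(\<Sum>t\<in>bip_rel G S T `` {s}. (if s \<in> S then 1 else - 1) + (if t \<in> S then 1 else - 1))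
      = 0 * (if s \<in> S then 1 else - 1 :: real)"
      using disj by (subst sum.neutral) (auto simp: bip_rel_def)
  next
    fix t assume "t \<in> T"
    then show "(\<Sum>s\<in>bip_rel G T S `` {t}. (if t \<in> S then 1 else - 1) + (if s \<in> S then 1 else - 1))
      = 0 * (if t \<in> S then 1 else - 1 :: real)"
      using disj by (subst sum.neutral) (auto simp: bip_rel_def)
  qed
  then have "\<exists>f. EV 0 f" by blast
  then have "eigenvalue ?Q 0" by (simp only: ev)
  then have "{c. eigenvalue ?Q c} \<noteq> {}" by blast
  then have "q_index G \<in> {c. eigenvalue ?Q c}" unfolding q_index_def using finite by (intro Max_in)
  then have "eigenvalue ?Q (q_index G)" by (rule CollectD)
  then have "\<exists>f. EV (q_index G) f" by (simp only: ev)
  then obtain f where "EV (q_index G) f" by (rule exE)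
  then show ?thesis using that[of f] unfolding EV_def by blast
qed

theorem theorem1p6:
  fixes G :: "'a ugraph" and k n :: nat
  assumes "k > 1"
    and "n \<ge> k^4 + 3 * k^3 + 5 * k\<^sup>2 + 5 * k + 4"
    and "simple_graph G"
    and "balanced_bipartite G"
    and "card (verts G) = 2 * n"
    and "min_degree G \<ge> k"
    and "q_index G \<ge> 2 * real n - real k"
  shows "hamiltonian G \<or> in_B1_family G n k"
proof (cases "hamiltonian G")
  case False
  obtain S T where bip: "bipartition G S T" and cST: "card S = card T"
    using assms(4) by (auto simp: balanced_bipartite_def)
  note bip' = bipartition_swap[OF bip]
  have V: "verts G = S \<union> T" and disj: "S \<inter> T = {}" using bip by (auto simp: bipartition_def)
  have finV: "finite (verts G)" using assms(3) by (simp add: simple_graph_def)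
  then have fin: "finite S" "finite T" using V by auto
  have card: "card S = n" "card T = n" using assms(5) V cST card_Un_disjoint[OF fin disj] by auto
  let ?E = "bip_rel G S T"
  have E: "?E \<subseteq> S \<times> T" "?E\<inverse> \<subseteq> T \<times> S" by (auto simp: bip_rel_def)
  have n: "4 * k\<^sup>2 + 4 * k < n" using assms(2) by linarith
  have ne: "S \<noteq> {}" using card n by auto
  have deg: "k \<le> vdegree G v" if "v \<in> S \<union> T" for v
  proof -
    have "min_degree G \<le> vdegree G v" unfolding min_degree_def using finV V that by (intro Min_le) auto
    then show ?thesis using assms(6) by linarith
  qed
  have dS: "k \<le> card (?E `` {s})" if "s \<in> S" for s
    using deg[of s] vdegree_bip_rel[OF bip that] that by simp
  have dT: "k \<le> card (?E\<inverse> `` {t})" if "t \<in> T" for t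
    using deg[of t] vdegree_bip_rel[OF bip' that] that by (simp add: bip_rel_converse)
  obtain f :: "'a \<Rightarrow> real" where f: "\<exists>v\<in>S \<union> T. f v \<noteq> 0"
    "\<And>s. s \<in> S \<Longrightarrow> (\<Sum>t\<in>?E `` {s}. f s + f t) = q_index G * f s"
    "\<And>t. t \<in> T \<Longrightarrow> (\<Sum>s\<in>?E\<inverse> `` {t}. f t + f s) = q_index G * f t"
    using q_index_eigenvector[OF bip fin ne] by (auto simp: bip_rel_converse)
  have card_E: "n * n \<le> card ?E + n * k"
  proof (rule edge_bound[OF fin E(1) card f(2,3) assms(7) _ _ _ disj f(1)])
    show "k \<le> n" using n by linarith
  qed (use dS dT assms(1) in force)+
  have non: "\<not> ham_rel (S \<union> T) (?E \<union> ?E\<inverse>)"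
  proof
    have R: "{u, v} \<in> edges G" if "(u, v) \<in> ?E \<union> ?E\<inverse>" for u v
      using that by (auto simp: bip_rel_def insert_commute)
    assume "ham_rel (S \<union> T) (?E \<union> ?E\<inverse>)"
    then have "hamiltonian G" unfolding ham_rel_def hamiltonian_def hamiltonian_cycle_def V using R by blast
    then show False using False by simp
  qed
  have k: "1 \<le> k" "2 \<le> k" using assms(1) by auto
  \<comment> \<open>The low vertices may lie in \<open>S\<close> or in \<open>T\<close>; the second
    case is the first with the sides exchanged and \<open>?E\<close> replaced by its
    converse.\<close>
  consider X Y where "X \<subseteq> S" "card X = k" "Y \<subseteq> T" "card Y = k" "?E \<inter> X \<times> (T - Y) = {}"
    | X Y where "X \<subseteq> T" "card X = k" "Y \<subseteq> S" "card Y = k" "?E\<inverse> \<inter> X \<times> (S - Y) = {}"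
    using ham_rel_or_block[OF fin disj E(1) card k(1) n dS dT card_E non] by blast
  then have "in_B1_family G n k"
  proof cases
    case (1 X Y)
    note X = 1(1,2) and Y = 1(3,4) and XY = 1(5)
    have "card ((S - X) \<times> T - ?E) \<le> k\<^sup>2 div 4"
      by (rule few_missing_edges[OF fin E(1) card f(2,3) assms(7) k(2) assms(2) f(1) X Y XY])
    then show ?thesis using in_B1_family_of_block[OF fin bip card X Y XY] dS X by auto
  next
    case (2 X Y)
    note X = 2(1,2) and Y = 2(3,4) and XY = 2(5)
    have "card ((T - X) \<times> S - ?E\<inverse>) \<le> k\<^sup>2 div 4"
      by (rule few_missing_edges[OF fin(2,1) E(2) card(2,1) f(3) _ assms(7) k(2) assms(2) _ X Y XY])
        (use f in auto)
    then show ?thesis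
      using in_B1_family_of_block[OF fin(2,1) bip' card(2,1) X Y] XY dT X by (auto simp: bip_rel_converse)
  qed
  then show ?thesis ..
qed simp

end
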